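(* Let $(X_i)_{i\ge1}$ (resp. $(Y_i)_{i\ge1}$) be a sequence of i.i.d. real valued random variables with distribution function $F_0$ (resp. $F_1$), the two sequences being independent of each other. Suppose that $X_1$ (resp. $Y_1$) has finite expectation $\mu_0$ (resp. $\mu_1$) and finite variance $\sigma_0^2$ (resp. $\sigma_1^2$, with $\sigma_1>0$). Suppose furthermore that $\beta_3=E[|Y_1|^3]<\infty$ and let $\alpha\in(0,1)$. Let $k=k_n$ satisfy $k\sim n^\alpha$ as $n\to\infty$, and let $F_+$ be the distribution function of $$\Delta_{n,+k}=\frac{1}{n+k}\left(\sum_{i=1}^n X_i+\sum_{j=1}^k Y_j\right)-\frac1n\sum_{i=1}^nX_i .$$ Put $\beta=\min\left(\frac{\alpha}{2},1-\alpha\right)$. Then, as $n\to\infty$, $$F_+\left(\frac{\sqrt{k}\,\sigma_1x}{n}\right)=\Phi\left(x-\frac{n}{n+k}\,\frac{\sqrt{k}(\mu_1-\mu_0)}{\sigma_1}\right)+\mathcal{O}(n^{-\beta})$$ uniformly in $x\in\mathbb{R}$. Moreover, if $x$ is restricted to a bounded range and $\mu_1\neq\mu_0$, then $$F_+\left(\frac{\sqrt{k}\,\sigma_1x}{n}\right)=\Phi\left(x-\frac{\sqrt{k}(\mu_1-\mu_0)}{\sigma_1}\right)+\mathcal{O}(n^{-\beta})$$ uniformly for $x$ in that bounded range.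
   Context: $\Phi$ is the standard normal distribution function. $k=k_n$ is a sequence of positive integers, and $k\sim n^\alpha$ means $k_n/n^\alpha\to1$. $\Delta_{n,+k}$ is the change in the sample mean when $k$ new observations with distribution function $F_1$ are added to $n$ observations with distribution function $F_0$. *)

theory Defs
  imports "HOL-Probability.Probability"
begin

definition distribution_function :: "'a measure \<Rightarrow> ('a \<Rightarrow> real) \<Rightarrow> real \<Rightarrow> real" where
  "distribution_function M Z = cdf (distr M borel Z)"

definition std_normal_cdf :: "real \<Rightarrow> real" ("\<Phi>") where
  "\<Phi> = cdf std_normal_distribution"

text \<open>
  Sequences are indexed from 1; the value at index 0 is never used. The whole sequences,
  not just pairs \<open>(X i, Y j)\<close>, are independent of each other, hence the random elements of
  the product space.
\<close>

definition iid_with_df :: "'a measure \<Rightarrow> (nat \<Rightarrow> 'a \<Rightarrow> real) \<Rightarrow> (real \<Rightarrow> real) \<Rightarrow> bool" where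
  "iid_with_df M X F \<longleftrightarrow>
     prob_space.indep_vars M (\<lambda>_. borel) X {1..} \<and>
     (\<forall>i\<ge>1. distribution_function M (X i) = F)"

definition indep_sequences :: "'a measure \<Rightarrow> (nat \<Rightarrow> 'a \<Rightarrow> real) \<Rightarrow> (nat \<Rightarrow> 'a \<Rightarrow> real) \<Rightarrow> bool" where
  "indep_sequences M X Y \<longleftrightarrow>
     prob_space.indep_var M
       (PiM {1..} (\<lambda>_. borel)) (\<lambda>\<omega>. \<lambda>i\<in>{1..}. X i \<omega>)
       (PiM {1..} (\<lambda>_. borel)) (\<lambda>\<omega>. \<lambda>j\<in>{1..}. Y j \<omega>)"

definition Delta_add ::
  "(nat \<Rightarrow> 'a \<Rightarrow> real) \<Rightarrow> (nat \<Rightarrow> 'a \<Rightarrow> real) \<Rightarrow> nat \<Rightarrow> nat \<Rightarrow> 'a \<Rightarrow> real" where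
  "Delta_add X Y n k \<omega> =
     1 / (real n + real k) * ((\<Sum>i=1..n. X i \<omega>) + (\<Sum>j=1..k. Y j \<omega>))
       - 1 / real n * (\<Sum>i=1..n. X i \<omega>)"

text \<open>\<open>f n x = O(g n)\<close> as \<open>n \<rightarrow> \<infinity>\<close>, with one constant and one threshold valid for all \<open>x \<in> S\<close>.\<close>

definition bigo_uniformly_on ::
  "real set \<Rightarrow> (nat \<Rightarrow> real \<Rightarrow> real) \<Rightarrow> (nat \<Rightarrow> real) \<Rightarrow> bool" where
  "bigo_uniformly_on S f g \<longleftrightarrow>
     (\<exists>C>0. eventually (\<lambda>n. \<forall>x\<in>S. \<bar>f n x\<bar> \<le> C * \<bar>g n\<bar>) sequentially)"

end

theory Submission
  imports Defs
begin

text \<open>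
  Multiplied out, the event \<open>\<Delta>\<^sub>n \<le> \<surd>k \<sigma>\<^sub>1 x / n\<close> reads
  \<open>T - U \<le> (1 + k/n) x - \<surd>k (\<mu>\<^sub>1 - \<mu>\<^sub>0) / \<sigma>\<^sub>1\<close>, where \<open>T\<close> is the standardised sum of the
  new observations and \<open>U\<close>, independent of \<open>T\<close>, is a centred multiple of the sum of the old ones
  with variance \<open>(k/n) \<sigma>\<^sub>0\<^sup>2/\<sigma>\<^sub>1\<^sup>2\<close>. The Berry--Esseen theorem replaces the law of \<open>T\<close> by the
  normal law at cost \<open>O(k\<^sup>-\<^sup>1\<^sup>/\<^sup>2)\<close>; a second order Taylor expansion of \<open>\<Phi>\<close> in \<open>U\<close>, whose linear
  term vanishes, and the change from \<open>(1 + k/n) y\<close> to \<open>y\<close> each cost \<open>O(k/n)\<close>.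

  The Berry--Esseen theorem for i.i.d. summands is obtained by Stein's method. With \<open>V\<close> the
  normalised sum without its last term \<open>D\<close>, exchangeability gives
  \<open>E W f(W) = N E D (f(V + D) - f V)\<close> for \<open>W = V + D\<close>. A clamped linear \<open>f\<close> bounds the
  probability that \<open>V\<close> lies in a short interval, and this controls the jump at \<open>z\<close> of the
  derivative of the solution of Stein's equation for the half-line up to \<open>z\<close>.
\<close>

section \<open>The standard normal distribution function\<close>

interpretation std_normal: real_distribution std_normal_distribution
  by (rule real_dist_normal_dist)

lemma std_normal_density_has_derivative [derivative_intros]:
  assumes "(g has_real_derivative g') (at x within S)"
  shows "((\<lambda>x. std_normal_density (g x)) has_real_derivative (- g x * std_normal_density (g x) * g')) (at x within S)"
  unfolding std_normal_density_def using assms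
  by (auto intro!: derivative_eq_intros simp: field_simps)

lemma continuous_on_std_normal_density: "continuous_on A std_normal_density"
  unfolding std_normal_density_def[abs_def] by (intro continuous_intros) auto

lemma std_normal_cdf_diff:
  assumes "a \<le> b"
  shows "\<Phi> b - \<Phi> a = integral {a..b} std_normal_density"
proof (cases "a = b")
  case False
  then have ab: "a < b" using assms by simp
  have "\<Phi> b - \<Phi> a = measure std_normal_distribution {a<..b}"
    unfolding std_normal_cdf_def using ab by (rule std_normal.cdf_diff_eq)
  also have "\<dots> = (LINT x|std_normal_distribution. indicator {a<..b} x)"
    by simp
  also have "\<dots> = (LINT x:{a<..b}|lborel. std_normal_density x)"
    by (subst integral_density) (auto simp: set_lebesgue_integral_def mult.commute)
  also have "\<dots> = integral {a<..b} std_normal_density"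
    by (intro set_borel_integral_eq_integral) (use integrable_mult_indicator[of "{a<..b}" lborel std_normal_density] in \<open>simp add: set_integrable_def\<close>)
  also have "\<dots> = integral {a..b} std_normal_density"
    by (intro integral_spike_set)
       (auto intro: negligible_subset[of "{a}"])
  finally show ?thesis .
qed auto

lemma std_normal_cdf_has_derivative [derivative_intros]:
  assumes "(g has_real_derivative g') (at x within S)"
  shows "((\<lambda>x. \<Phi> (g x)) has_real_derivative (std_normal_density (g x) * g')) (at x within S)"
proof -
  have "(\<Phi> has_real_derivative std_normal_density t) (at t)" for t
  proof -
    \<comment> \<open>The base point \<open>t - 1\<close> makes \<open>t\<close> an interior point
      of the interval, so the derivative within the interval is a full derivative.\<close>
    have "((\<lambda>u. integral {t - 1..u} std_normal_density) has_real_derivative std_normal_density t)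
            (at t within {t - 1..t + 1})"
      by (rule integral_has_real_derivative[OF continuous_on_std_normal_density]) auto
    then have D: "((\<lambda>u. \<Phi> (t - 1) + integral {t - 1..u} std_normal_density) has_real_derivative std_normal_density t)
            (at t within {t - 1..t + 1})"
      by (auto intro!: derivative_eq_intros)
    have "(\<Phi> has_real_derivative std_normal_density t) (at t within {t - 1..t + 1})"
    proof (rule has_field_derivative_transform_within[OF D zero_less_one])
      show "\<Phi> (t - 1) + integral {t - 1..u} std_normal_density = \<Phi> u" if "u \<in> {t - 1..t + 1}" for u
        using std_normal_cdf_diff[of "t - 1" u] that by simp
    qed simp
    moreover have "at t within {t - 1..t + 1} = at t"
      by (rule at_within_interior) auto
    ultimately show ?thesis by simp
  qed
  from DERIV_chain2[OF this assms] show ?thesis by simp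
qed

lemma std_normal_cdf_le_1: "\<Phi> x \<le> 1"
  and std_normal_cdf_nonneg: "0 \<le> \<Phi> x"
  and std_normal_cdf_mono: "x \<le> y \<Longrightarrow> \<Phi> x \<le> \<Phi> y"
  unfolding std_normal_cdf_def
  by (auto intro: std_normal.cdf_bounded_prob std_normal.cdf_nonneg std_normal.cdf_nondecreasing)

lemma std_normal_cdf_measurable [measurable]: "\<Phi> \<in> borel_measurable borel"
  by (rule borel_measurable_mono) (auto simp: mono_def std_normal_cdf_mono)

lemma std_normal_density_minus [simp]: "std_normal_density (- x) = std_normal_density x"
  by (simp add: std_normal_density_def)

text \<open>The density is even, so the sum of the two values has derivative zero; the constant is
  its limit 1 + 0 at infinity.\<close>

lemma std_normal_cdf_minus: "\<Phi> (- x) = 1 - \<Phi> x"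
proof -
  have "((\<lambda>x. \<Phi> x + \<Phi> (- x)) has_real_derivative 0) (at x)" for x
    by (auto intro!: derivative_eq_intros)
  then have const: "\<Phi> y + \<Phi> (- y) = \<Phi> x + \<Phi> (- x)" for y
    using DERIV_isconst_all[of "\<lambda>x. \<Phi> x + \<Phi> (- x)"] by blast
  have "((\<lambda>y. \<Phi> y + \<Phi> (- y)) \<longlongrightarrow> 1 + 0) at_top"
    unfolding std_normal_cdf_def
    by (intro tendsto_add std_normal.cdf_lim_at_top_prob
        filterlim_compose[OF std_normal.cdf_lim_at_bot filterlim_uminus_at_bot_at_top])
  then have "\<Phi> x + \<Phi> (- x) = 1"
    by (subst (asm) const) (simp add: tendsto_const_iff)
  then show ?thesis by simp
qed

section \<open>Bounds on the normal density and on Mills' ratio\<close>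

lemma std_normal_density_le_1: "std_normal_density x \<le> 1"
proof -
  have "1 \<le> sqrt (2 * pi)" using pi_ge_two by (simp add: real_le_rsqrt)
  moreover have "exp (- x\<^sup>2 / 2) \<le> 1" by simp
  ultimately show ?thesis
    unfolding std_normal_density_def
    by (smt (verit) divide_le_eq_1_pos exp_gt_zero mult_le_one times_divide_eq_left zero_le_divide_1_iff mult_1)
qed

text \<open>From |x| \<le> 1 + x^2/2 \<le> exp (x^2/2); the factor 1 / sqrt (2 pi) enters only
  through being at most 1.\<close>

lemma mult_std_normal_density_le_1: "\<bar>x\<bar> * std_normal_density x \<le> 1"
proof -
  have "1 \<le> sqrt (2 * pi)" using pi_ge_two by (simp add: real_le_rsqrt)
  have "\<bar>x\<bar> \<le> 1 + x\<^sup>2 / 2"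
    using sum_squares_bound[of 1 "\<bar>x\<bar>"] by (simp add: power2_eq_square)
  also have "\<dots> \<le> exp (x\<^sup>2 / 2)" by (rule exp_ge_add_one_self)
  finally have "\<bar>x\<bar> * exp (- x\<^sup>2 / 2) \<le> 1"
    by (simp add: exp_minus field_simps)
  also note \<open>1 \<le> sqrt (2 * pi)\<close>
  finally have "\<bar>x\<bar> * exp (- x\<^sup>2 / 2) / sqrt (2 * pi) \<le> 1"
    by (subst divide_le_eq_1) auto
  then show ?thesis
    unfolding std_normal_density_def by simp
qed

lemma tendsto_std_normal_density_at_top: "(std_normal_density \<longlongrightarrow> 0) at_top"
proof (rule tendsto_sandwich[where f = "\<lambda>_. 0" and h = "\<lambda>x. 1 / x"])
  show "\<forall>\<^sub>F x in at_top. std_normal_density x \<le> 1 / x"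
    using eventually_gt_at_top[of 0]
  proof eventually_elim
    case (elim x)
    then show ?case using mult_std_normal_density_le_1[of x] by (simp add: field_simps)
  qed
  show "((\<lambda>x::real. 1 / x) \<longlongrightarrow> 0) at_top"
    by (rule tendsto_divide_0[OF tendsto_const filterlim_at_top_imp_at_infinity[OF filterlim_ident]])
qed auto

text \<open>The quotient of the density by x, minus the upper tail, has a negative derivative on the
  positive half-line and tends to 0 at infinity. Hence it is nonnegative.\<close>

lemma mills_bound:
  assumes "x > 0"
  shows "x * \<Phi> (- x) \<le> std_normal_density x"
proof -
  define g where "g = (\<lambda>x. std_normal_density x / x - \<Phi> (- x))"
  have "g t \<le> g x" if "x \<le> t" for t
  proof (rule DERIV_nonpos_imp_nonincreasing[OF that])
    fix u assume "x \<le> u"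
    then have "u > 0" using assms by simp
    have "(g has_real_derivative (- std_normal_density u / u\<^sup>2)) (at u)"
      unfolding g_def using \<open>u > 0\<close>
      by (auto intro!: derivative_eq_intros) (simp add: power2_eq_square field_simps)
    moreover have "- std_normal_density u / u\<^sup>2 \<le> 0" by (simp add: divide_nonpos_nonneg)
    ultimately show "\<exists>y. (g has_real_derivative y) (at u) \<and> y \<le> 0" by blast
  qed
  moreover have "(g \<longlongrightarrow> 0 - 0) at_top"
    unfolding g_def
  proof (intro tendsto_diff)
    show "((\<lambda>x. std_normal_density x / x) \<longlongrightarrow> 0) at_top"
      by (rule tendsto_divide_0[OF tendsto_std_normal_density_at_top filterlim_at_top_imp_at_infinity[OF filterlim_ident]])
    show "((\<lambda>x. \<Phi> (- x)) \<longlongrightarrow> 0) at_top"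
      unfolding std_normal_cdf_def
      by (rule filterlim_compose[OF std_normal.cdf_lim_at_bot filterlim_uminus_at_bot_at_top])
  qed
  ultimately have "0 \<le> g x"
    by (intro tendsto_upperbound[of g 0 at_top]) (auto simp: eventually_at_top_linorder)
  then show ?thesis using assms by (simp add: g_def field_simps)
qed

text \<open>This is \<open>stein_solution w w\<close>, the largest value that the solutions take at
  the point \<open>w\<close> as the threshold \<open>z\<close> varies.\<close>

definition normal_mills_product :: "real \<Rightarrow> real" where
  "normal_mills_product w = \<Phi> w * \<Phi> (- w) / std_normal_density w"

lemma normal_mills_product_minus: "normal_mills_product (- w) = normal_mills_product w"
  by (simp add: normal_mills_product_def std_normal_density_def)

lemma normal_mills_product_nonneg: "0 \<le> normal_mills_product w"
  by (simp add: normal_mills_product_def std_normal_cdf_nonneg)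

lemma abs_mult_normal_mills_product_le: "\<bar>w\<bar> * normal_mills_product w \<le> 1"
proof -
  have *: "w * normal_mills_product w \<le> 1" if "w > 0" for w
  proof -
    have "\<Phi> w * (w * \<Phi> (- w)) \<le> 1 * std_normal_density w"
      using that by (intro mult_mono mills_bound std_normal_cdf_le_1) (auto simp: std_normal_cdf_nonneg)
    then show ?thesis using normal_density_pos[of 1 0 w]
      by (simp add: normal_mills_product_def field_simps)
  qed
  consider "w > 0" | "w = 0" | "- w > 0" by linarith
  then show ?thesis
    using *[of w] *[of "- w"] by cases (auto simp: normal_mills_product_minus)
qed

text \<open>For |w| \<ge> 1 the bound 1 follows from the preceding lemma. For |w| < 1 the numerator
  is at most 1/4 and the reciprocal density at most 9, which gives 9/4; the constant 5 is a round
  upper bound.\<close>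

lemma normal_mills_product_le: "normal_mills_product w \<le> 5"
proof (cases "\<bar>w\<bar> \<ge> 1")
  case True
  then have "1 * normal_mills_product w \<le> \<bar>w\<bar> * normal_mills_product w"
    by (intro mult_right_mono normal_mills_product_nonneg)
  then show ?thesis using abs_mult_normal_mills_product_le[of w] by simp
next
  case False
  have "sqrt (2 * pi) \<le> 3" using pi_less_4 by (intro real_le_lsqrt) auto
  moreover have "exp (w\<^sup>2 / 2) \<le> 3"
  proof -
    have "w\<^sup>2 \<le> 1" using False by (simp add: abs_square_le_1)
    then have "exp (w\<^sup>2 / 2) \<le> exp 1" by simp
    then show ?thesis using exp_le by linarith
  qed
  ultimately have "sqrt (2 * pi) * exp (w\<^sup>2 / 2) \<le> 3 * 3" by (intro mult_mono) auto
  then have 1: "1 / std_normal_density w \<le> 9"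
    by (simp add: std_normal_density_def exp_minus field_simps)
  have "0 \<le> (\<Phi> w - 1/2)\<^sup>2" by simp
  then have 2: "\<Phi> w * \<Phi> (- w) \<le> 1/4"
    by (simp add: std_normal_cdf_minus power2_eq_square algebra_simps)
  have "normal_mills_product w = \<Phi> w * \<Phi> (- w) * (1 / std_normal_density w)"
    by (simp add: normal_mills_product_def)
  also have "\<dots> \<le> 1/4 * 9"
    using 1 2 by (intro mult_mono) auto
  finally show ?thesis by simp
qed

section \<open>Comparing \<Phi> at two arguments\<close>

lemma std_normal_cdf_mvt:
  obtains t where "min x y \<le> t" "t \<le> max x y" "\<Phi> y - \<Phi> x = (y - x) * std_normal_density t"
proof -
  have d: "(\<Phi> has_real_derivative std_normal_density t) (at t)" for t
    using std_normal_cdf_has_derivative[OF DERIV_ident, of t UNIV] by simp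
  consider "x < y" | "x = y" | "y < x" by linarith
  then show ?thesis
  proof cases
    case 1
    then obtain t where "x < t" "t < y" "\<Phi> y - \<Phi> x = (y - x) * std_normal_density t"
      using MVT2[of x y \<Phi> std_normal_density] d by blast
    then show ?thesis by (intro that[of t]) auto
  next
    case 2
    then show ?thesis by (intro that[of x]) auto
  next
    case 3
    then obtain t where "y < t" "t < x" "\<Phi> x - \<Phi> y = (x - y) * std_normal_density t"
      using MVT2[of y x \<Phi> std_normal_density] d by blast
    then show ?thesis by (intro that[of t]) (auto simp: algebra_simps)
  qed
qed

lemma std_normal_density_lipschitz: "\<bar>std_normal_density x - std_normal_density y\<bar> \<le> \<bar>x - y\<bar>"
proof -
  have "norm (std_normal_density x - std_normal_density y) \<le> 1 * norm (x - y)"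
  proof (rule field_differentiable_bound[of UNIV std_normal_density "\<lambda>t. - t * std_normal_density t"])
    show "(std_normal_density has_real_derivative - t * std_normal_density t) (at t within UNIV)" for t
      using std_normal_density_has_derivative[OF DERIV_ident, of t UNIV] by simp
    show "norm (- t * std_normal_density t) \<le> 1" for t
      using mult_std_normal_density_le_1[of t] by (simp add: abs_mult)
  qed auto
  then show ?thesis by simp
qed

text \<open>The mean value theorem for \<Phi> is followed by the Lipschitz bound on the density at
  the intermediate point. The error is uniform in \<open>a\<close>, so averaging over a centred
  random \<open>u\<close> costs no more than its variance.\<close>

lemma std_normal_cdf_taylor: "\<bar>\<Phi> (a + u) - \<Phi> a - u * std_normal_density a\<bar> \<le> u\<^sup>2"
proof -
  obtain t where t: "min a (a + u) \<le> t" "t \<le> max a (a + u)" "\<Phi> (a + u) - \<Phi> a = (a + u - a) * std_normal_density t"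
    by (rule std_normal_cdf_mvt)
  have "\<bar>std_normal_density t - std_normal_density a\<bar> \<le> \<bar>u\<bar>"
    using std_normal_density_lipschitz[of t a] t(1,2) by auto
  then have "\<bar>u\<bar> * \<bar>std_normal_density t - std_normal_density a\<bar> \<le> \<bar>u\<bar> * \<bar>u\<bar>"
    by (rule mult_left_mono) simp
  moreover have "\<Phi> (a + u) - \<Phi> a - u * std_normal_density a = u * (std_normal_density t - std_normal_density a)"
    unfolding t(3) by (simp add: algebra_simps)
  ultimately show ?thesis by (simp add: abs_mult power2_eq_square)
qed

text \<open>Multiplication by 1 + c \<ge> 1 moves y away from 0, so the intermediate point t
  satisfies |y| \<le> |t|, and the boundedness of |t| times the density at t absorbs the factor
  y.\<close>

lemma std_normal_cdf_scale:
  assumes "0 \<le> c"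
  shows "\<bar>\<Phi> ((1 + c) * y) - \<Phi> y\<bar> \<le> c"
proof -
  obtain t where t: "min y ((1 + c) * y) \<le> t" "t \<le> max y ((1 + c) * y)"
    "\<Phi> ((1 + c) * y) - \<Phi> y = ((1 + c) * y - y) * std_normal_density t"
    by (rule std_normal_cdf_mvt)
  have "\<bar>y\<bar> \<le> \<bar>t\<bar>"
  proof (cases "y \<ge> 0")
    case True
    then have "y \<le> (1 + c) * y" using assms by (simp add: distrib_right)
    then show ?thesis using t True by simp
  next
    case False
    then have "c * y \<le> 0" using assms by (simp add: mult_nonneg_nonpos)
    then have "(1 + c) * y \<le> y" by (simp add: distrib_right)
    then show ?thesis using t False by simp
  qed
  then have "\<bar>y\<bar> * std_normal_density t \<le> \<bar>t\<bar> * std_normal_density t"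
    by (rule mult_right_mono) simp
  then have "\<bar>y\<bar> * std_normal_density t \<le> 1"
    using mult_std_normal_density_le_1[of t] by linarith
  then have "c * (\<bar>y\<bar> * std_normal_density t) \<le> c * 1"
    using assms by (rule mult_left_mono)
  moreover have "\<Phi> ((1 + c) * y) - \<Phi> y = c * (y * std_normal_density t)"
    unfolding t(3) by (simp add: algebra_simps)
  ultimately show ?thesis using assms by (simp add: abs_mult)
qed

text \<open>If \<open>\<bar>m\<bar>\<close> is large, the density near \<open>x - m\<close> is \<open>O(1/\<bar>m\<bar>)\<close>, which compensates the
  factor \<open>m\<close> in the difference of the arguments.\<close>

lemma std_normal_cdf_shift:
  assumes "0 < n" "0 \<le> k" "\<bar>x\<bar> \<le> b"
  shows "\<bar>\<Phi> (x - n / (n + k) * m) - \<Phi> (x - m)\<bar> \<le> (4 + 4 * b) * (k / n)"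
proof (cases "k \<le> n")
  case False
  have "\<bar>\<Phi> (x - n / (n + k) * m) - \<Phi> (x - m)\<bar> \<le> 1"
    using std_normal_cdf_nonneg[of "x - n / (n + k) * m"] std_normal_cdf_nonneg[of "x - m"]
      std_normal_cdf_le_1[of "x - n / (n + k) * m"] std_normal_cdf_le_1[of "x - m"] by linarith
  also have "1 \<le> (4 + 4 * b) * (k / n)"
    using mult_mono[of 1 "4 + 4 * b" 1 "k / n"] False assms by simp
  finally show ?thesis .
next
  case True
  define r where "r = n / (n + k)"
  \<comment> \<open>The case assumption k \<le> n keeps r * m between m/2 and m.\<close>
  have r: "1 / 2 \<le> r" "r \<le> 1" using True assms by (auto simp: r_def field_simps)
  have "1 - r = k / (n + k)" using assms by (simp add: r_def field_simps)
  also have "\<dots> \<le> k / n" using assms by (intro divide_left_mono) auto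
  finally have r1: "1 - r \<le> k / n" .
  obtain t where t: "min (x - m) (x - r * m) \<le> t" "t \<le> max (x - m) (x - r * m)"
    "\<Phi> (x - r * m) - \<Phi> (x - m) = (x - r * m - (x - m)) * std_normal_density t"
    by (rule std_normal_cdf_mvt)
  have "\<bar>m\<bar> * std_normal_density t \<le> 4 + 4 * b"
  proof (cases "\<bar>m\<bar> \<le> 4 * b")
    case True
    then have "\<bar>m\<bar> * std_normal_density t \<le> 4 * b * 1"
      by (intro mult_mono std_normal_density_le_1) auto
    then show ?thesis by simp
  next
    case False
    \<comment> \<open>Here |x| \<le> b < |m|/4, while m and r * m have the same sign and size at
      least |m|/2. Both endpoints therefore lie on the same side of 0 at distance at least |m|/4,
      and so does t between them.\<close>
    have "\<bar>m\<bar> / 4 \<le> \<bar>t\<bar>"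
    proof (cases "m \<ge> 0")
      case True
      then have "m / 2 \<le> r * m" "r * m \<le> m"
        using r mult_right_mono[of "1/2" r m] mult_right_mono[of r 1 m] by linarith+
      then show ?thesis using t(2) True False assms(3) by linarith
    next
      case m: False
      then have "r * m \<le> m / 2" "m \<le> r * m"
        using r mult_right_mono_neg[of "1/2" r m] mult_right_mono_neg[of r 1 m] by linarith+
      then show ?thesis using t(1) m False assms(3) by linarith
    qed
    then have "\<bar>m\<bar> * std_normal_density t \<le> 4 * (\<bar>t\<bar> * std_normal_density t)"
      using mult_right_mono[of "\<bar>m\<bar>" "4 * \<bar>t\<bar>" "std_normal_density t"] by simp
    also have "\<dots> \<le> 4" using mult_std_normal_density_le_1[of t] by simp
    finally show ?thesis using assms(3) by linarith
  qed
  then have "(1 - r) * (\<bar>m\<bar> * std_normal_density t) \<le> k / n * (4 + 4 * b)"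
    using r r1 assms by (intro mult_mono) auto
  moreover have "\<Phi> (x - r * m) - \<Phi> (x - m) = (1 - r) * (m * std_normal_density t)"
    unfolding t(3) by (simp add: algebra_simps)
  ultimately show ?thesis using r unfolding r_def[symmetric] by (simp add: abs_mult mult.commute)
qed

section \<open>Stein's equation\<close>

text \<open>The bounded solution f of Stein's equation f'(w) - w f(w) = 1(w \<le> z) - \<Phi> z, in
  closed form through tails of \<Phi> instead of an integral.\<close>

definition stein_solution :: "real \<Rightarrow> real \<Rightarrow> real" where
  "stein_solution z w =
     (if w \<le> z then \<Phi> w * \<Phi> (- z) else \<Phi> (- w) * \<Phi> z) / std_normal_density w"

text \<open>Read off from Stein's equation rather than defined as a derivative, so that the equation
  holds at every point, including the corner w = z.\<close>

definition stein_derivative :: "real \<Rightarrow> real \<Rightarrow> real" where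
  "stein_derivative z w = w * stein_solution z w + (if w \<le> z then 1 else 0) - \<Phi> z"

lemma stein_solution_nonneg: "0 \<le> stein_solution z w"
  by (simp add: stein_solution_def std_normal_cdf_nonneg)

lemma stein_solution_le_mills: "stein_solution z w \<le> normal_mills_product w"
proof -
  have "\<Phi> w * \<Phi> (- z) \<le> \<Phi> w * \<Phi> (- w)" if "w \<le> z"
    using that by (intro mult_left_mono std_normal_cdf_mono std_normal_cdf_nonneg) simp
  moreover have "\<Phi> (- w) * \<Phi> z \<le> \<Phi> w * \<Phi> (- w)" if "\<not> w \<le> z"
    unfolding mult.commute[of "\<Phi> w"]
    using that by (intro mult_left_mono std_normal_cdf_mono std_normal_cdf_nonneg) simp
  ultimately show ?thesis
    unfolding stein_solution_def normal_mills_product_def by (intro divide_right_mono) auto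
qed

lemma abs_stein_solution_le: "\<bar>stein_solution z w\<bar> \<le> 5"
  using stein_solution_nonneg[of z w] stein_solution_le_mills[of z w] normal_mills_product_le[of w] by simp

lemma abs_mult_stein_solution_le: "\<bar>w * stein_solution z w\<bar> \<le> 1"
proof -
  have "\<bar>w\<bar> * stein_solution z w \<le> \<bar>w\<bar> * normal_mills_product w"
    by (intro mult_left_mono stein_solution_le_mills) auto
  then show ?thesis
    using abs_mult_normal_mills_product_le[of w] stein_solution_nonneg[of z w] by (simp add: abs_mult)
qed

lemma abs_stein_derivative_le: "\<bar>stein_derivative z w\<bar> \<le> 2"
  using abs_mult_stein_solution_le[of w z] std_normal_cdf_nonneg[of z] std_normal_cdf_le_1[of z]
  unfolding stein_derivative_def by (simp split: if_split) linarith

section \<open>Regularity of the Stein solution\<close>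

lemma continuous_on_std_normal_cdf: "continuous_on A \<Phi>"
  by (rule continuous_at_imp_continuous_on)
     (blast intro: DERIV_isCont std_normal_cdf_has_derivative[OF DERIV_ident])

lemma continuous_on_stein_solution: "continuous_on UNIV (stein_solution z)"
proof -
  have cont: "continuous_on UNIV (\<lambda>w. \<Phi> (g w))" if "continuous_on UNIV g" for g :: "real \<Rightarrow> real"
    by (rule continuous_on_compose2[OF continuous_on_std_normal_cdf[of UNIV] that]) auto
  have "continuous_on UNIV (\<lambda>w. if w \<le> z then \<Phi> w * \<Phi> (- z) else \<Phi> (- w) * \<Phi> z)"
    by (rule continuous_on_cases_le[where h = "\<lambda>w. w"])
       (auto intro!: continuous_on_mult continuous_on_const continuous_on_minus continuous_on_id
          continuous_on_subset[OF cont] simp: mult.commute)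
  then have "continuous_on UNIV
    (\<lambda>w. (if w \<le> z then \<Phi> w * \<Phi> (- z) else \<Phi> (- w) * \<Phi> z) / std_normal_density w)"
    using normal_density_pos[of 1 0]
    by (intro continuous_on_divide continuous_on_std_normal_density) (auto simp: less_imp_neq[symmetric])
  then show ?thesis
    by (simp add: stein_solution_def[abs_def])
qed

lemma stein_solution_measurable [measurable]: "stein_solution z \<in> borel_measurable borel"
  by (intro borel_measurable_continuous_onI continuous_on_stein_solution)

lemma stein_derivative_measurable [measurable]: "stein_derivative z \<in> borel_measurable borel"
  unfolding stein_derivative_def[abs_def] by measurable

text \<open>Near a point other than z only one branch is active. The logarithmic derivative of the
  density is -w, so the quotient rule produces w f(w) plus the constant \<Phi> (-z) = 1 - \<Phi> z
  on the left of z and -\<Phi> z on the right.\<close>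

lemma stein_solution_has_derivative:
  assumes "w \<noteq> z"
  shows "(stein_solution z has_real_derivative stein_derivative z w) (at w)"
proof -
  have pos: "std_normal_density w \<noteq> 0" using normal_density_pos[of 1 0 w] by simp
  show ?thesis
  proof (cases "w < z")
    case True
    have "((\<lambda>w. \<Phi> w * \<Phi> (- z) / std_normal_density w) has_real_derivative stein_derivative z w) (at w)"
      by (rule DERIV_cong[OF DERIV_divide[OF DERIV_cmult_right[OF std_normal_cdf_has_derivative[OF DERIV_ident]]
              std_normal_density_has_derivative[OF DERIV_ident] pos]])
         (use True pos in \<open>simp add: stein_derivative_def stein_solution_def std_normal_cdf_minus[of z]
              diff_divide_distrib add_divide_distrib ring_distribs mult_ac\<close>)
    then show ?thesis
      by (rule has_field_derivative_transform_within_open[where S = "{..<z}"])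
         (use True in \<open>auto simp: stein_solution_def\<close>)
  next
    case False
    have "((\<lambda>w. \<Phi> (- w) * \<Phi> z / std_normal_density w) has_real_derivative stein_derivative z w) (at w)"
      by (rule DERIV_cong[OF DERIV_divide[OF DERIV_cmult_right[OF std_normal_cdf_has_derivative[OF DERIV_minus[OF DERIV_ident]]]
              std_normal_density_has_derivative[OF DERIV_ident] pos]])
         (use False assms pos in \<open>simp add: stein_derivative_def stein_solution_def
              diff_divide_distrib add_divide_distrib ring_distribs mult_ac\<close>)
    then show ?thesis
      by (rule has_field_derivative_transform_within_open[where S = "{z<..}"])
         (use False assms in \<open>auto simp: stein_solution_def\<close>)
  qed
qed

text \<open>The point z may be an endpoint: the mean value theorem asks for continuity there, not
  for a derivative.\<close>

lemma stein_solution_mvt: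
  assumes "a < b" and "z \<notin> {a<..<b}"
  obtains t where "a < t" "t < b" "stein_solution z b - stein_solution z a = (b - a) * stein_derivative z t"
proof -
  have d: "(stein_solution z has_real_derivative stein_derivative z x) (at x)" if "a < x" "x < b" for x
    using that assms by (intro stein_solution_has_derivative) auto
  have "continuous_on {a..b} (stein_solution z)"
    by (rule continuous_on_subset[OF continuous_on_stein_solution]) simp
  moreover have "stein_solution z differentiable (at x)" if "a < x" "x < b" for x
    using d[OF that] real_differentiable_def by blast
  ultimately obtain l t where t: "a < t" "t < b" "(stein_solution z has_real_derivative l) (at t)"
    "stein_solution z b - stein_solution z a = (b - a) * l"
    using MVT[OF assms(1), of "stein_solution z"] by blast
  then have "l = stein_derivative z t" using d[of t] DERIV_unique by blast
  then show ?thesis using that t by blast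
qed

text \<open>An interval with the corner z in its interior is cut at z; on each piece the derivative
  is bounded by 2, and the two bounds add up to the bound for the whole interval.\<close>

lemma stein_solution_lipschitz: "\<bar>stein_solution z a - stein_solution z b\<bar> \<le> 2 * \<bar>a - b\<bar>"
proof -
  have *: "\<bar>stein_solution z b - stein_solution z a\<bar> \<le> 2 * (b - a)" if "a \<le> b" and z: "z \<notin> {a<..<b}" for a b
  proof (cases "a = b")
    case False
    with that have "a < b" by simp
    then obtain t where "stein_solution z b - stein_solution z a = (b - a) * stein_derivative z t"
      by (rule stein_solution_mvt[OF _ z])
    then show ?thesis
      using that mult_left_mono[OF abs_stein_derivative_le[of z t], of "b - a"] by (simp add: abs_mult)
  qed auto
  have **: "\<bar>stein_solution z b - stein_solution z a\<bar> \<le> 2 * (b - a)" if "a \<le> b" for a b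
  proof (cases "z \<in> {a<..<b}")
    case True
    then show ?thesis using *[of a z] *[of z b] by auto
  qed (use * that in auto)
  show ?thesis using **[of a b] **[of b a] by (cases "a \<le> b") auto
qed

text \<open>The product w f(w) varies by at most |w| times the Lipschitz bound 2 |x|, plus |x| times
  the supremum bound 5. The indicator in the derivative can change only if z lies within |x| of
  w.\<close>

lemma stein_derivative_diff_le:
  "\<bar>stein_derivative z (w + x) - stein_derivative z w\<bar>
     \<le> (2 * \<bar>w\<bar> + 5) * \<bar>x\<bar> + (if \<bar>w - z\<bar> \<le> \<bar>x\<bar> then 1 else 0)"
proof -
  have "(w + x) * stein_solution z (w + x) - w * stein_solution z w
      = w * (stein_solution z (w + x) - stein_solution z w) + x * stein_solution z (w + x)"
    by (simp add: algebra_simps)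
  moreover have "\<bar>w * (stein_solution z (w + x) - stein_solution z w)\<bar> \<le> \<bar>w\<bar> * (2 * \<bar>x\<bar>)"
    unfolding abs_mult using stein_solution_lipschitz[of z "w + x" w]
    by (intro mult_left_mono) auto
  moreover have "\<bar>x * stein_solution z (w + x)\<bar> \<le> \<bar>x\<bar> * 5"
    unfolding abs_mult by (intro mult_left_mono abs_stein_solution_le) auto
  ultimately have "\<bar>(w + x) * stein_solution z (w + x) - w * stein_solution z w\<bar> \<le> (2 * \<bar>w\<bar> + 5) * \<bar>x\<bar>"
    by (simp add: algebra_simps)
  moreover have "\<bar>(if w + x \<le> z then 1 else 0) - (if w \<le> z then 1 else 0 :: real)\<bar>
    \<le> (if \<bar>w - z\<bar> \<le> \<bar>x\<bar> then 1 else 0)"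
    by auto
  ultimately show ?thesis
    unfolding stein_derivative_def by linarith
qed

text \<open>If z is within |x| of w, the increment and the linear term are each at most 2 |x|,
  whence the 4. Otherwise the segment avoids z, the increment is x times the derivative at an
  intermediate point, and the derivative varies there without a jump.\<close>

lemma stein_solution_taylor:
  "\<bar>stein_solution z (w + x) - stein_solution z w - x * stein_derivative z w\<bar>
     \<le> \<bar>x\<bar> * ((2 * \<bar>w\<bar> + 5) * \<bar>x\<bar> + (if \<bar>w - z\<bar> \<le> \<bar>x\<bar> then 4 else 0))"
proof (cases "\<bar>w - z\<bar> \<le> \<bar>x\<bar>")
  case True
  have "\<bar>x * stein_derivative z w\<bar> \<le> \<bar>x\<bar> * 2"
    unfolding abs_mult by (intro mult_left_mono abs_stein_derivative_le) auto
  moreover have "\<bar>stein_solution z (w + x) - stein_solution z w\<bar> \<le> 2 * \<bar>x\<bar>"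
    using stein_solution_lipschitz[of z "w + x" w] by simp
  ultimately have "\<bar>stein_solution z (w + x) - stein_solution z w - x * stein_derivative z w\<bar> \<le> 2 * \<bar>x\<bar> + \<bar>x\<bar> * 2"
    by (intro order_trans[OF abs_triangle_ineq4[of "stein_solution z (w + x) - stein_solution z w"]] add_mono)
  also have "\<dots> \<le> \<bar>x\<bar> * ((2 * \<bar>w\<bar> + 5) * \<bar>x\<bar> + 4)"
    by (simp add: distrib_left)
  finally show ?thesis using True by simp
next
  case False
  obtain t where t: "\<bar>t\<bar> \<le> \<bar>x\<bar>"
    "stein_solution z (w + x) - stein_solution z w = x * stein_derivative z (w + t)"
  proof (cases "x = 0")
    case True
    then show ?thesis by (intro that[of 0]) auto
  next
    case x: False
    show ?thesis
    proof (cases "x > 0")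
      case True
      then have "w < w + x" "z \<notin> {w<..<w + x}" using False by auto
      then obtain s where "w < s" "s < w + x"
        "stein_solution z (w + x) - stein_solution z w = (w + x - w) * stein_derivative z s"
        by (rule stein_solution_mvt)
      then show ?thesis by (intro that[of "s - w"]) auto
    next
      case False
      then have "w + x < w" "z \<notin> {w + x<..<w}" using \<open>\<not> \<bar>w - z\<bar> \<le> \<bar>x\<bar>\<close> x by auto
      then obtain s where "w + x < s" "s < w"
        "stein_solution z w - stein_solution z (w + x) = (w - (w + x)) * stein_derivative z s"
        by (rule stein_solution_mvt)
      then show ?thesis by (intro that[of "s - w"]) (auto simp: algebra_simps)
    qed
  qed
  have "\<bar>stein_derivative z (w + t) - stein_derivative z w\<bar> \<le> (2 * \<bar>w\<bar> + 5) * \<bar>t\<bar>"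
    using stein_derivative_diff_le[of z w t] False t(1) by (simp split: if_splits)
  also have "\<dots> \<le> (2 * \<bar>w\<bar> + 5) * \<bar>x\<bar>"
    using t by (intro mult_left_mono) auto
  finally have "\<bar>x\<bar> * \<bar>stein_derivative z (w + t) - stein_derivative z w\<bar> \<le> \<bar>x\<bar> * ((2 * \<bar>w\<bar> + 5) * \<bar>x\<bar>)"
    by (intro mult_left_mono) auto
  moreover have "stein_solution z (w + x) - stein_solution z w - x * stein_derivative z w
      = x * (stein_derivative z (w + t) - stein_derivative z w)"
    unfolding t(2) by (simp add: algebra_simps)
  ultimately show ?thesis using False by (simp add: abs_mult)
qed

section \<open>Stein's method for a sum with one independent summand split off\<close>

lemma integrable_mult_bounded:
  fixes f g :: "'a \<Rightarrow> real"
  assumes "integrable M g" "f \<in> borel_measurable M" "\<And>x. \<bar>f x\<bar> \<le> B"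
  shows "integrable M (\<lambda>x. g x * f x)"
proof (rule Bochner_Integration.integrable_bound)
  show "integrable M (\<lambda>x. B * g x)" using assms by simp
  show "AE x in M. norm (g x * f x) \<le> norm (B * g x)"
  proof (rule AE_I2)
    fix x
    have "\<bar>f x\<bar> \<le> \<bar>B\<bar>" using assms(3)[of x] by simp
    then have "\<bar>g x\<bar> * \<bar>f x\<bar> \<le> \<bar>g x\<bar> * \<bar>B\<bar>" by (rule mult_left_mono) simp
    then show "norm (g x * f x) \<le> norm (B * g x)" by (simp add: abs_mult mult.commute)
  qed
qed (use assms in measurable)

text \<open>Conditioning on \<open>D\<close> in the form of Fubini's theorem: the joint law is the
  product of the two laws, so an estimate proved for each frozen value \<open>d\<close> may be
  integrated over the law of \<open>D\<close>.\<close>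

lemma (in prob_space) indep_var_expectation_le:
  fixes f :: "real \<Rightarrow> real \<Rightarrow> real"
  assumes ind: "indep_var borel V borel D"
    and [measurable]: "case_prod f \<in> borel_measurable (borel \<Otimes>\<^sub>M borel)"
    and int: "integrable M (\<lambda>\<omega>. f (V \<omega>) (D \<omega>))"
    and g: "g \<in> borel_measurable borel" "integrable M (\<lambda>\<omega>. g (D \<omega>))"
    and le: "\<And>d. expectation (\<lambda>\<omega>. f (V \<omega>) d) \<le> g d"
  shows "expectation (\<lambda>\<omega>. f (V \<omega>) (D \<omega>)) \<le> expectation (\<lambda>\<omega>. g (D \<omega>))"
proof -
  have [measurable]: "V \<in> borel_measurable M" "D \<in> borel_measurable M"
    using ind by (auto dest: indep_var_rv1 indep_var_rv2)
  define P where "P = distr M borel V"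
  define Q where "Q = distr M borel D"
  interpret P: prob_space P unfolding P_def by (rule prob_space_distr) simp
  interpret Q: prob_space Q unfolding Q_def by (rule prob_space_distr) simp
  interpret PQ: pair_prob_space P Q ..
  have PQ: "P \<Otimes>\<^sub>M Q = distr M (borel \<Otimes>\<^sub>M borel) (\<lambda>\<omega>. (V \<omega>, D \<omega>))"
    using ind unfolding indep_var_distribution_eq P_def Q_def by blast
  have int': "integrable (P \<Otimes>\<^sub>M Q) (case_prod f)"
    unfolding PQ by (subst integrable_distr_eq) (use int in auto)
  have "expectation (\<lambda>\<omega>. f (V \<omega>) (D \<omega>)) = (\<integral>z. case_prod f z \<partial>(P \<Otimes>\<^sub>M Q))"
    unfolding PQ by (subst integral_distr) auto
  also have "\<dots> = (\<integral>d. (\<integral>v. f v d \<partial>P) \<partial>Q)"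
    using PQ.integral_snd[OF int'] by simp
  also have "\<dots> \<le> (\<integral>d. g d \<partial>Q)"
  proof (rule integral_mono)
    show "integrable Q (\<lambda>d. \<integral>v. f v d \<partial>P)" by (rule PQ.integrable_snd[OF int'])
    show "integrable Q g" unfolding Q_def using g by (subst integrable_distr_eq) auto
    show "(\<integral>v. f v d \<partial>P) \<le> g d" for d
      using le[of d] unfolding P_def by (subst integral_distr) auto
  qed
  also have "\<dots> = expectation (\<lambda>\<omega>. g (D \<omega>))"
    unfolding Q_def using g by (subst integral_distr) auto
  finally show ?thesis .
qed

lemma (in prob_space) indep_var_expectation_mult:
  fixes f g :: "real \<Rightarrow> real"
  assumes ind: "indep_var borel V borel D"
    and [measurable]: "f \<in> borel_measurable borel" "g \<in> borel_measurable borel"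
    and int: "integrable M (\<lambda>\<omega>. f (V \<omega>))" "integrable M (\<lambda>\<omega>. g (D \<omega>))"
  shows "expectation (\<lambda>\<omega>. f (V \<omega>) * g (D \<omega>)) = expectation (\<lambda>\<omega>. f (V \<omega>)) * expectation (\<lambda>\<omega>. g (D \<omega>))"
    and "integrable M (\<lambda>\<omega>. f (V \<omega>) * g (D \<omega>))"
proof -
  have "indep_var borel (f \<circ> V) borel (g \<circ> D)"
    by (rule indep_var_compose[OF ind]) auto
  then show "expectation (\<lambda>\<omega>. f (V \<omega>) * g (D \<omega>)) = expectation (\<lambda>\<omega>. f (V \<omega>)) * expectation (\<lambda>\<omega>. g (D \<omega>))"
    and "integrable M (\<lambda>\<omega>. f (V \<omega>) * g (D \<omega>))"
    using indep_var_lebesgue_integral[of "f \<circ> V" "g \<circ> D"] indep_var_integrable[of "f \<circ> V" "g \<circ> D"] int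
    by (simp_all add: comp_def)
qed

text \<open>\<open>D\<close> models one of \<open>N\<close> identically distributed summands and
  \<open>V\<close> the sum of the others; \<gamma> bounds the total third absolute moment. It is
  strictly positive because it serves as the width of a clamp and as a denominator.
  \<open>stein_id\<close> is what exchangeability provides for bounded test functions.\<close>

locale stein_pair = prob_space +
  fixes V D :: "'a \<Rightarrow> real" and N \<gamma> :: real
  assumes indep: "indep_var borel V borel D"
    and integrable_V: "integrable M V"
    and integrable_D2: "integrable M (\<lambda>\<omega>. (D \<omega>)\<^sup>2)"
    and integrable_D3: "integrable M (\<lambda>\<omega>. \<bar>D \<omega>\<bar> ^ 3)"
    and mean_D: "expectation D = 0"
    and N_pos: "0 < N"
    and var_D: "N * expectation (\<lambda>\<omega>. (D \<omega>)\<^sup>2) = 1"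
    and third_D: "N * expectation (\<lambda>\<omega>. \<bar>D \<omega>\<bar> ^ 3) \<le> \<gamma>"
    and \<gamma>_pos: "0 < \<gamma>"
    and abs_V: "expectation (\<lambda>\<omega>. \<bar>V \<omega>\<bar>) \<le> 1"
    and abs_W: "expectation (\<lambda>\<omega>. \<bar>V \<omega> + D \<omega>\<bar>) \<le> 1"
    and stein_id: "\<And>f B. f \<in> borel_measurable borel \<Longrightarrow> (\<And>x. \<bar>f x\<bar> \<le> B) \<Longrightarrow>
      expectation (\<lambda>\<omega>. (V \<omega> + D \<omega>) * f (V \<omega> + D \<omega>)) = N * expectation (\<lambda>\<omega>. D \<omega> * f (V \<omega> + D \<omega>))"
begin

lemma measurable_VD [measurable]: "V \<in> borel_measurable M" "D \<in> borel_measurable M"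
  using indep by (auto dest: indep_var_rv1 indep_var_rv2)

lemma integrable_D: "integrable M D"
  by (rule square_integrable_imp_integrable[OF _ integrable_D2]) simp

lemma expectation_D_mult_V:
  assumes [measurable]: "f \<in> borel_measurable borel" and "\<And>x. \<bar>f x\<bar> \<le> B"
  shows "expectation (\<lambda>\<omega>. D \<omega> * f (V \<omega>)) = 0"
proof -
  have "integrable M (\<lambda>\<omega>. f (V \<omega>))"
    by (rule integrable_const_bound[of _ B]) (use assms in auto)
  from indep_var_expectation_mult(1)[OF indep assms(1) _ this, of "\<lambda>x. x"] show ?thesis
    using integrable_D mean_D by (simp add: mult.commute)
qed

text \<open>The test function is the identity on \<open>[a - \<gamma>/2, b + \<gamma>/2]\<close> and constant outside, so
  that \<open>x (f (v + x) - f v) \<ge> \<bar>x\<bar> min \<bar>x\<bar> (\<gamma>/2) \<ge> x\<^sup>2 - \<bar>x\<bar>\<^sup>3/(2\<gamma>)\<close> for \<open>v \<in> [a, b]\<close>.\<close>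

lemma concentration:
  assumes "a \<le> b"
  shows "prob {\<omega> \<in> space M. a \<le> V \<omega> \<and> V \<omega> \<le> b} \<le> (b - a) + \<gamma>"
proof -
  define \<delta> where "\<delta> = \<gamma> / 2"
  have \<delta>: "\<delta> > 0" using \<gamma>_pos by (simp add: \<delta>_def)
  \<comment> \<open>Subtracting the midpoint makes the supremum of |f| half the length of the
    clamping interval, which is \<open>B\<close>.\<close>
  define f where "f = (\<lambda>w. max (a - \<delta>) (min (b + \<delta>) w) - (a + b) / 2)"
  define B where "B = (b - a) / 2 + \<delta>"
  define I where "I = (\<lambda>v::real. indicator {a..b} v :: real)"
  have [measurable]: "f \<in> borel_measurable borel" unfolding f_def by measurable
  have [measurable]: "I \<in> borel_measurable borel" unfolding I_def by measurable
  have f_bound: "\<bar>f x\<bar> \<le> B" for x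
    using assms \<delta> by (auto simp: f_def B_def max_def min_def field_simps)
  have key: "I v * (x\<^sup>2 - \<bar>x\<bar> ^ 3 / (2 * \<gamma>)) \<le> x * f (v + x) - x * f v" for v x
  proof -
    have mono: "0 \<le> x * (f (v + x) - f v)"
      by (cases "x \<ge> 0") (auto simp: f_def max_def min_def zero_le_mult_iff)
    show ?thesis
    proof (cases "v \<in> {a..b}")
      case True
      have "\<bar>x\<bar> * min \<bar>x\<bar> \<delta> \<le> x * (f (v + x) - f v)"
      proof (cases "x \<ge> 0")
        case x: True
        then have "min \<bar>x\<bar> \<delta> \<le> f (v + x) - f v"
          using True \<delta> by (auto simp: f_def max_def min_def)
        then show ?thesis using x by (simp add: mult_left_mono)
      next
        case x: False
        then have "min \<bar>x\<bar> \<delta> \<le> - (f (v + x) - f v)"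
          using True \<delta> by (auto simp: f_def max_def min_def)
        then have "\<bar>x\<bar> * min \<bar>x\<bar> \<delta> \<le> \<bar>x\<bar> * - (f (v + x) - f v)"
          by (rule mult_left_mono) simp
        then show ?thesis using x by (simp add: algebra_simps)
      qed
      moreover have "x\<^sup>2 - \<bar>x\<bar> ^ 3 / (4 * \<delta>) \<le> \<bar>x\<bar> * min \<bar>x\<bar> \<delta>"
      proof (cases "\<bar>x\<bar> \<le> \<delta>")
        case True
        then show ?thesis using \<delta> by (simp add: power2_eq_square[symmetric])
      next
        case False
        \<comment> \<open>Expanding this square says that x^2 - |x|^3 / (4 \<delta>) lies below |x|
          \<delta>: the cubic correction pays for the truncation of the increment at
          \<delta>.\<close>
        have "0 \<le> \<bar>x\<bar> * (2 * \<delta> - \<bar>x\<bar>)\<^sup>2" by simp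
        then have "x\<^sup>2 * (4 * \<delta>) - \<bar>x\<bar> ^ 3 \<le> \<bar>x\<bar> * \<delta> * (4 * \<delta>)"
          by (simp add: power2_eq_square power3_eq_cube algebra_simps)
        then have "(x\<^sup>2 * (4 * \<delta>) - \<bar>x\<bar> ^ 3) / (4 * \<delta>) \<le> \<bar>x\<bar> * \<delta>"
          using \<delta> by (subst pos_divide_le_eq) auto
        then show ?thesis using False \<delta> by (simp add: diff_divide_distrib)
      qed
      ultimately show ?thesis using True by (simp add: I_def \<delta>_def right_diff_distrib)
    next
      case False
      then show ?thesis using mono by (simp add: I_def right_diff_distrib)
    qed
  qed
  have intW: "integrable M (\<lambda>\<omega>. D \<omega> * f (V \<omega> + D \<omega>))" and intV: "integrable M (\<lambda>\<omega>. D \<omega> * f (V \<omega>))"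
    by (rule integrable_mult_bounded[OF integrable_D _ f_bound], measurable)+
  have intI: "integrable M (\<lambda>\<omega>. I (V \<omega>))"
    by (rule integrable_const_bound[of _ 1]) (auto simp: I_def indicator_def)
  define p where "p = prob {\<omega> \<in> space M. a \<le> V \<omega> \<and> V \<omega> \<le> b}"
  have p: "expectation (\<lambda>\<omega>. I (V \<omega>)) = p"
  proof -
    have "expectation (\<lambda>\<omega>. I (V \<omega>)) = expectation (indicator {\<omega> \<in> space M. a \<le> V \<omega> \<and> V \<omega> \<le> b})"
      by (rule Bochner_Integration.integral_cong) (auto simp: I_def indicator_def)
    then show ?thesis by (simp add: p_def Int_def conj_ac)
  qed
  have int_g: "integrable M (\<lambda>\<omega>. (D \<omega>)\<^sup>2 - \<bar>D \<omega>\<bar> ^ 3 / (2 * \<gamma>))"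
    using integrable_D2 integrable_D3 by simp
  note prod = indep_var_expectation_mult[OF indep _ _ intI int_g]
  \<comment> \<open>The width \<delta> = \<gamma>/2 is chosen so that the cubic correction takes
    away at most half of the total variance 1. The remaining half yields p/2 \<le> B, that is, the
    claim.\<close>
  have "N * expectation (\<lambda>\<omega>. \<bar>D \<omega>\<bar> ^ 3) / (2 * \<gamma>) \<le> 1 / 2"
    using third_D \<gamma>_pos by (simp add: pos_divide_le_eq)
  then have "1 / 2 \<le> N * (expectation (\<lambda>\<omega>. (D \<omega>)\<^sup>2) - expectation (\<lambda>\<omega>. \<bar>D \<omega>\<bar> ^ 3) / (2 * \<gamma>))"
    using var_D by (simp add: right_diff_distrib)
  then have "p * (1 / 2) \<le> p * (N * (expectation (\<lambda>\<omega>. (D \<omega>)\<^sup>2) - expectation (\<lambda>\<omega>. \<bar>D \<omega>\<bar> ^ 3) / (2 * \<gamma>)))"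
    by (rule mult_left_mono) (simp add: p_def)
  also have "\<dots> = N * expectation (\<lambda>\<omega>. I (V \<omega>) * ((D \<omega>)\<^sup>2 - \<bar>D \<omega>\<bar> ^ 3 / (2 * \<gamma>)))"
    using integrable_D2 integrable_D3 by (subst prod(1)) (auto simp: p)
  also have "\<dots> \<le> N * expectation (\<lambda>\<omega>. D \<omega> * f (V \<omega> + D \<omega>) - D \<omega> * f (V \<omega>))"
    using N_pos intW intV
    by (intro mult_left_mono integral_mono key prod(2)) auto
  also have "\<dots> = N * expectation (\<lambda>\<omega>. D \<omega> * f (V \<omega> + D \<omega>))"
    using intW intV expectation_D_mult_V[of f B] f_bound by simp
  also have "\<dots> = expectation (\<lambda>\<omega>. (V \<omega> + D \<omega>) * f (V \<omega> + D \<omega>))"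
    by (rule stein_id[symmetric, OF _ f_bound]) simp
  also have "\<dots> \<le> expectation (\<lambda>\<omega>. \<bar>V \<omega> + D \<omega>\<bar> * B)"
  proof (rule integral_mono)
    show "integrable M (\<lambda>\<omega>. (V \<omega> + D \<omega>) * f (V \<omega> + D \<omega>))"
      by (rule integrable_mult_bounded[OF _ _ f_bound]) (use integrable_V integrable_D in auto)
    show "(V \<omega> + D \<omega>) * f (V \<omega> + D \<omega>) \<le> \<bar>V \<omega> + D \<omega>\<bar> * B" for \<omega>
      using mult_left_mono[OF f_bound[of "V \<omega> + D \<omega>"], of "\<bar>V \<omega> + D \<omega>\<bar>"]
      by (metis abs_ge_self abs_ge_zero abs_mult order_trans)
  qed (use integrable_V integrable_D in auto)
  also have "\<dots> = B * expectation (\<lambda>\<omega>. \<bar>V \<omega> + D \<omega>\<bar>)" by (simp add: mult.commute)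
  also have "\<dots> \<le> B * 1"
    using assms \<delta> by (intro mult_left_mono abs_W) (simp add: B_def)
  finally show ?thesis by (simp add: p_def B_def \<delta>_def field_simps)
qed

text \<open>With \<open>D\<close> frozen at d, the condition places \<open>V\<close> in an interval
  of length 2 |d|, whose probability \<open>concentration\<close> bounds by 2 |d| + \<gamma>. The
  weight \<open>q\<close> will be 1 for the jump of the derivative and the square for the Taylor
  remainder.\<close>

lemma expectation_near:
  fixes q :: "real \<Rightarrow> real"
  assumes [measurable]: "q \<in> borel_measurable borel" and q: "\<And>x. 0 \<le> q x"
    and int: "integrable M (\<lambda>\<omega>. q (D \<omega>))" "integrable M (\<lambda>\<omega>. q (D \<omega>) * \<bar>D \<omega>\<bar>)"
  shows "expectation (\<lambda>\<omega>. q (D \<omega>) * (if \<bar>V \<omega> - z\<bar> \<le> \<bar>D \<omega>\<bar> then 1 else 0))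
    \<le> 2 * expectation (\<lambda>\<omega>. q (D \<omega>) * \<bar>D \<omega>\<bar>) + \<gamma> * expectation (\<lambda>\<omega>. q (D \<omega>))"
    (is "?L \<le> ?R")
proof -
  have "?L \<le> expectation (\<lambda>\<omega>. q (D \<omega>) * (2 * \<bar>D \<omega>\<bar> + \<gamma>))"
  proof (rule indep_var_expectation_le[OF indep, where f = "\<lambda>v d. q d * (if \<bar>v - z\<bar> \<le> \<bar>d\<bar> then 1 else 0)" and g = "\<lambda>d. q d * (2 * \<bar>d\<bar> + \<gamma>)"])
    show "integrable M (\<lambda>\<omega>. q (D \<omega>) * (if \<bar>V \<omega> - z\<bar> \<le> \<bar>D \<omega>\<bar> then 1 else 0))"
      by (rule integrable_mult_bounded[OF int(1), of _ 1]) auto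
    show "integrable M (\<lambda>\<omega>. q (D \<omega>) * (2 * \<bar>D \<omega>\<bar> + \<gamma>))"
      using int by (simp add: distrib_left mult.left_commute)
    fix d
    have "expectation (\<lambda>\<omega>. if \<bar>V \<omega> - z\<bar> \<le> \<bar>d\<bar> then 1 else 0)
        = expectation (indicator {\<omega> \<in> space M. z - \<bar>d\<bar> \<le> V \<omega> \<and> V \<omega> \<le> z + \<bar>d\<bar>})"
      by (rule Bochner_Integration.integral_cong) (auto simp: indicator_def)
    also have "\<dots> = prob {\<omega> \<in> space M. z - \<bar>d\<bar> \<le> V \<omega> \<and> V \<omega> \<le> z + \<bar>d\<bar>}"
      by (simp add: Int_def conj_ac)
    also have "\<dots> \<le> 2 * \<bar>d\<bar> + \<gamma>"
      using concentration[of "z - \<bar>d\<bar>" "z + \<bar>d\<bar>"] by simp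
    finally show "expectation (\<lambda>\<omega>. q d * (if \<bar>V \<omega> - z\<bar> \<le> \<bar>d\<bar> then 1 else 0)) \<le> q d * (2 * \<bar>d\<bar> + \<gamma>)"
      using q by (simp add: mult_left_mono)
  qed measurable
  also have "\<dots> = ?R"
    using int by (simp add: distrib_left mult.left_commute[of _ 2] mult.commute[of \<gamma>])
  finally show ?thesis .
qed

text \<open>Independence separates the two factors, and 7 = 2 * 1 + 5 because the mean of |V| is at
  most 1.\<close>

lemma expectation_abs_V_mult:
  fixes q :: "real \<Rightarrow> real"
  assumes [measurable]: "q \<in> borel_measurable borel" and q: "\<And>x. 0 \<le> q x"
    and int: "integrable M (\<lambda>\<omega>. q (D \<omega>))"
  shows "expectation (\<lambda>\<omega>. (2 * \<bar>V \<omega>\<bar> + 5) * q (D \<omega>)) \<le> 7 * expectation (\<lambda>\<omega>. q (D \<omega>))"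
    and "integrable M (\<lambda>\<omega>. (2 * \<bar>V \<omega>\<bar> + 5) * q (D \<omega>))"
proof -
  have 1: "integrable M (\<lambda>\<omega>. 2 * \<bar>V \<omega>\<bar> + 5)" using integrable_V by simp
  note * = indep_var_expectation_mult[OF indep _ _ 1 int]
  show "integrable M (\<lambda>\<omega>. (2 * \<bar>V \<omega>\<bar> + 5) * q (D \<omega>))" by (rule *(2)) measurable
  have "expectation (\<lambda>\<omega>. (2 * \<bar>V \<omega>\<bar> + 5) * q (D \<omega>))
     = expectation (\<lambda>\<omega>. 2 * \<bar>V \<omega>\<bar> + 5) * expectation (\<lambda>\<omega>. q (D \<omega>))"
    by (rule *(1)) measurable
  also have "\<dots> \<le> 7 * expectation (\<lambda>\<omega>. q (D \<omega>))"
    using integrable_V abs_V q by (intro mult_right_mono integral_nonneg_AE) (auto simp: prob_space)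
  finally show "expectation (\<lambda>\<omega>. (2 * \<bar>V \<omega>\<bar> + 5) * q (D \<omega>)) \<le> 7 * expectation (\<lambda>\<omega>. q (D \<omega>))"
    .
qed

text \<open>Stein's equation at W = V + D writes the error as E h(W) - E W f(W). Both terms are
  compared with E h(V): the first through the variation of h, the second through
  \<open>stein_id\<close> and a Taylor expansion of f at V.\<close>

theorem normal_approximation:
  "\<bar>prob {\<omega> \<in> space M. V \<omega> + D \<omega> \<le> z} - \<Phi> z\<bar> \<le> 9 * expectation (\<lambda>\<omega>. \<bar>D \<omega>\<bar>) + 20 * \<gamma>"
proof -
  let ?f = "stein_solution z" and ?h = "stein_derivative z"
  let ?near = "\<lambda>\<omega>. if \<bar>V \<omega> - z\<bar> \<le> \<bar>D \<omega>\<bar> then 1 else 0 :: real"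
  note f_bound = abs_stein_solution_le[of z] and h_bound = abs_stein_derivative_le[of z]
  have D3: "\<bar>x\<bar> * x\<^sup>2 = \<bar>x\<bar> ^ 3" "x\<^sup>2 * \<bar>x\<bar> = \<bar>x\<bar> ^ 3" for x :: real
    by (simp_all add: power2_eq_square power3_eq_cube)
  have int_h: "integrable M (\<lambda>\<omega>. ?h (V \<omega> + D \<omega>))" "integrable M (\<lambda>\<omega>. ?h (V \<omega>))"
    by (rule integrable_const_bound[of _ 2]; use h_bound in auto)+
  have int_Wf: "integrable M (\<lambda>\<omega>. (V \<omega> + D \<omega>) * ?f (V \<omega> + D \<omega>))"
    by (rule integrable_mult_bounded[OF _ _ f_bound]) (use integrable_V integrable_D in auto)
  have int_Df: "integrable M (\<lambda>\<omega>. D \<omega> * ?f (V \<omega> + D \<omega>))" "integrable M (\<lambda>\<omega>. D \<omega> * ?f (V \<omega>))"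
    by (rule integrable_mult_bounded[OF integrable_D _ f_bound], measurable)+
  have int_D2h: "integrable M (\<lambda>\<omega>. (D \<omega>)\<^sup>2 * ?h (V \<omega>))"
    by (rule integrable_mult_bounded[OF integrable_D2 _ h_bound]) measurable
  define p where "p = prob {\<omega> \<in> space M. V \<omega> + D \<omega> \<le> z}"

  have "p = expectation (indicator {\<omega> \<in> space M. V \<omega> + D \<omega> \<le> z})"
    by (simp add: p_def Int_def conj_ac)
  also have "\<dots> = expectation (\<lambda>\<omega>. ?h (V \<omega> + D \<omega>) - (V \<omega> + D \<omega>) * ?f (V \<omega> + D \<omega>) + \<Phi> z)"
    by (rule Bochner_Integration.integral_cong) (auto simp: indicator_def stein_derivative_def)
  also have "\<dots> = expectation (\<lambda>\<omega>. ?h (V \<omega> + D \<omega>)) - expectation (\<lambda>\<omega>. (V \<omega> + D \<omega>) * ?f (V \<omega> + D \<omega>)) + \<Phi> z"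
    using int_h int_Wf by (simp add: prob_space)
  finally have p: "p - \<Phi> z = expectation (\<lambda>\<omega>. ?h (V \<omega> + D \<omega>)) - expectation (\<lambda>\<omega>. (V \<omega> + D \<omega>) * ?f (V \<omega> + D \<omega>))"
    by simp

  have int_near: "integrable M ?near"
    by (rule integrable_const_bound[of _ 1]) auto
  have "\<bar>expectation (\<lambda>\<omega>. ?h (V \<omega> + D \<omega>)) - expectation (\<lambda>\<omega>. ?h (V \<omega>))\<bar>
      = \<bar>expectation (\<lambda>\<omega>. ?h (V \<omega> + D \<omega>) - ?h (V \<omega>))\<bar>"
    using int_h by simp
  also have "\<dots> \<le> expectation (\<lambda>\<omega>. \<bar>?h (V \<omega> + D \<omega>) - ?h (V \<omega>)\<bar>)"
    by (rule integral_abs_bound)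
  also have "\<dots> \<le> expectation (\<lambda>\<omega>. (2 * \<bar>V \<omega>\<bar> + 5) * \<bar>D \<omega>\<bar> + ?near \<omega>)"
    using expectation_abs_V_mult(2)[of abs] integrable_D int_h int_near
    by (intro integral_mono stein_derivative_diff_le Bochner_Integration.integrable_add) auto
  also have "\<dots> = expectation (\<lambda>\<omega>. (2 * \<bar>V \<omega>\<bar> + 5) * \<bar>D \<omega>\<bar>) + expectation ?near"
    using expectation_abs_V_mult(2)[of abs] integrable_D int_near
    by (intro Bochner_Integration.integral_add) auto
  \<comment> \<open>The 7 comes from \<open>expectation_abs_V_mult\<close>; the 2 and the lone
    \<gamma> come from \<open>expectation_near\<close> with weight 1.\<close>
  also have "\<dots> \<le> 7 * expectation (\<lambda>\<omega>. \<bar>D \<omega>\<bar>) + (2 * expectation (\<lambda>\<omega>. \<bar>D \<omega>\<bar>) + \<gamma>)"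
  proof (rule add_mono)
    show "expectation (\<lambda>\<omega>. (2 * \<bar>V \<omega>\<bar> + 5) * \<bar>D \<omega>\<bar>) \<le> 7 * expectation (\<lambda>\<omega>. \<bar>D \<omega>\<bar>)"
      by (rule expectation_abs_V_mult(1)) (use integrable_D in simp_all)
    have "expectation (\<lambda>\<omega>. 1 * ?near \<omega>) \<le> 2 * expectation (\<lambda>\<omega>. 1 * \<bar>D \<omega>\<bar>) + \<gamma> * expectation (\<lambda>_. 1)"
      by (rule expectation_near) (use integrable_D in simp_all)
    then show "expectation ?near \<le> 2 * expectation (\<lambda>\<omega>. \<bar>D \<omega>\<bar>) + \<gamma>"
      unfolding mult_1_left by (simp only: lebesgue_integral_const prob_space scaleR_one mult_1_right)
  qed
  finally have 1: "\<bar>expectation (\<lambda>\<omega>. ?h (V \<omega> + D \<omega>)) - expectation (\<lambda>\<omega>. ?h (V \<omega>))\<bar>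
      \<le> 9 * expectation (\<lambda>\<omega>. \<bar>D \<omega>\<bar>) + \<gamma>" by simp

  have int_near2: "integrable M (\<lambda>\<omega>. (D \<omega>)\<^sup>2 * ?near \<omega>)"
    by (rule integrable_mult_bounded[OF integrable_D2, of _ 1]) auto
  \<comment> \<open>The factor N E D^2 = 1 is inserted and merged with the other expectation by
    independence of V and D.\<close>
  have "expectation (\<lambda>\<omega>. ?h (V \<omega>)) = N * (expectation (\<lambda>\<omega>. ?h (V \<omega>)) * expectation (\<lambda>\<omega>. (D \<omega>)\<^sup>2))"
    using var_D by (simp add: mult.left_commute)
  also have "\<dots> = N * expectation (\<lambda>\<omega>. (D \<omega>)\<^sup>2 * ?h (V \<omega>))"
    using indep_var_expectation_mult(1)[OF indep _ _ int_h(2) integrable_D2] by (simp add: mult.commute)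
  finally have Eh: "expectation (\<lambda>\<omega>. ?h (V \<omega>)) = N * expectation (\<lambda>\<omega>. (D \<omega>)\<^sup>2 * ?h (V \<omega>))" .
  have "expectation (\<lambda>\<omega>. (V \<omega> + D \<omega>) * ?f (V \<omega> + D \<omega>)) = N * expectation (\<lambda>\<omega>. D \<omega> * ?f (V \<omega> + D \<omega>))"
    by (rule stein_id[OF _ f_bound]) simp
  \<comment> \<open>Subtracting D f(V), which has mean zero, produces an increment of f whose first
    order term is D^2 h(V).\<close>
  also have "expectation (\<lambda>\<omega>. D \<omega> * ?f (V \<omega> + D \<omega>))
      = expectation (\<lambda>\<omega>. D \<omega> * ?f (V \<omega> + D \<omega>) - D \<omega> * ?f (V \<omega>))"
    using int_Df expectation_D_mult_V[of ?f 5] f_bound by simp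
  finally have EWf: "expectation (\<lambda>\<omega>. (V \<omega> + D \<omega>) * ?f (V \<omega> + D \<omega>))
      = N * expectation (\<lambda>\<omega>. D \<omega> * ?f (V \<omega> + D \<omega>) - D \<omega> * ?f (V \<omega>))" .
  have "expectation (\<lambda>\<omega>. D \<omega> * ?f (V \<omega> + D \<omega>) - D \<omega> * ?f (V \<omega>) - (D \<omega>)\<^sup>2 * ?h (V \<omega>))
      = expectation (\<lambda>\<omega>. D \<omega> * ?f (V \<omega> + D \<omega>) - D \<omega> * ?f (V \<omega>)) - expectation (\<lambda>\<omega>. (D \<omega>)\<^sup>2 * ?h (V \<omega>))"
    by (intro Bochner_Integration.integral_diff Bochner_Integration.integrable_diff int_Df int_D2h)
  then have "\<bar>expectation (\<lambda>\<omega>. (V \<omega> + D \<omega>) * ?f (V \<omega> + D \<omega>)) - expectation (\<lambda>\<omega>. ?h (V \<omega>))\<bar>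
      = N * \<bar>expectation (\<lambda>\<omega>. D \<omega> * ?f (V \<omega> + D \<omega>) - D \<omega> * ?f (V \<omega>) - (D \<omega>)\<^sup>2 * ?h (V \<omega>))\<bar>"
    unfolding Eh EWf right_diff_distrib[symmetric] abs_mult using N_pos by simp
  also have "\<dots> \<le> N * expectation (\<lambda>\<omega>. (2 * \<bar>V \<omega>\<bar> + 5) * \<bar>D \<omega>\<bar> ^ 3 + 4 * ((D \<omega>)\<^sup>2 * ?near \<omega>))"
  proof (intro mult_left_mono order_trans[OF integral_abs_bound] integral_mono)
    show "integrable M (\<lambda>\<omega>. \<bar>D \<omega> * ?f (V \<omega> + D \<omega>) - D \<omega> * ?f (V \<omega>) - (D \<omega>)\<^sup>2 * ?h (V \<omega>)\<bar>)"
      using int_Df int_D2h by auto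
    show "integrable M (\<lambda>\<omega>. (2 * \<bar>V \<omega>\<bar> + 5) * \<bar>D \<omega>\<bar> ^ 3 + 4 * ((D \<omega>)\<^sup>2 * ?near \<omega>))"
      using expectation_abs_V_mult(2)[of "\<lambda>x. \<bar>x\<bar> ^ 3"] integrable_D3 int_near2
      by (intro Bochner_Integration.integrable_add) auto
    show "\<bar>D \<omega> * ?f (V \<omega> + D \<omega>) - D \<omega> * ?f (V \<omega>) - (D \<omega>)\<^sup>2 * ?h (V \<omega>)\<bar>
        \<le> (2 * \<bar>V \<omega>\<bar> + 5) * \<bar>D \<omega>\<bar> ^ 3 + 4 * ((D \<omega>)\<^sup>2 * ?near \<omega>)" for \<omega>
    proof -
      let ?v = "V \<omega>" and ?x = "D \<omega>"
      have pow: "\<bar>?x\<bar> ^ 3 = \<bar>?x\<bar> * (\<bar>?x\<bar> * \<bar>?x\<bar>)" "?x\<^sup>2 = \<bar>?x\<bar> * \<bar>?x\<bar>"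
        by (simp_all add: power3_eq_cube power2_eq_square)
      have expand: "y * (y * ((2 * v + 5) * y + (if P then 4 else 0)))
          = (2 * v + 5) * (y * (y * y)) + 4 * ((y * y) * (if P then 1 else 0))" for y v :: real and P
        by (simp add: algebra_simps)
      have "\<bar>?x * ?f (?v + ?x) - ?x * ?f ?v - ?x\<^sup>2 * ?h ?v\<bar> = \<bar>?x\<bar> * \<bar>?f (?v + ?x) - ?f ?v - ?x * ?h ?v\<bar>"
        by (simp add: abs_mult[symmetric] power2_eq_square algebra_simps)
      also have "\<dots> \<le> \<bar>?x\<bar> * (\<bar>?x\<bar> * ((2 * \<bar>?v\<bar> + 5) * \<bar>?x\<bar> + (if \<bar>?v - z\<bar> \<le> \<bar>?x\<bar> then 4 else 0)))"
        by (intro mult_left_mono stein_solution_taylor) simp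
      also have "\<dots> = (2 * \<bar>?v\<bar> + 5) * (\<bar>?x\<bar> * (\<bar>?x\<bar> * \<bar>?x\<bar>)) + 4 * ((\<bar>?x\<bar> * \<bar>?x\<bar>) * ?near \<omega>)"
        by (rule expand)
      finally show ?thesis unfolding pow .
    qed
  qed (use N_pos in simp)
  also have "\<dots> = N * (expectation (\<lambda>\<omega>. (2 * \<bar>V \<omega>\<bar> + 5) * \<bar>D \<omega>\<bar> ^ 3) + 4 * expectation (\<lambda>\<omega>. (D \<omega>)\<^sup>2 * ?near \<omega>))"
    using expectation_abs_V_mult(2)[of "\<lambda>x. \<bar>x\<bar> ^ 3"] integrable_D3 int_near2
    by (subst Bochner_Integration.integral_add) auto
  also have "\<dots> \<le> N * (7 * expectation (\<lambda>\<omega>. \<bar>D \<omega>\<bar> ^ 3)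
      + 4 * (2 * expectation (\<lambda>\<omega>. \<bar>D \<omega>\<bar> ^ 3) + \<gamma> * expectation (\<lambda>\<omega>. (D \<omega>)\<^sup>2)))"
  proof (intro mult_left_mono add_mono)
    show "expectation (\<lambda>\<omega>. (2 * \<bar>V \<omega>\<bar> + 5) * \<bar>D \<omega>\<bar> ^ 3) \<le> 7 * expectation (\<lambda>\<omega>. \<bar>D \<omega>\<bar> ^ 3)"
      by (rule expectation_abs_V_mult(1)) (use integrable_D3 in simp_all)
    show "expectation (\<lambda>\<omega>. (D \<omega>)\<^sup>2 * ?near \<omega>) \<le> 2 * expectation (\<lambda>\<omega>. \<bar>D \<omega>\<bar> ^ 3) + \<gamma> * expectation (\<lambda>\<omega>. (D \<omega>)\<^sup>2)"
      unfolding D3(2)[symmetric]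
      by (rule expectation_near) (use integrable_D2 integrable_D3 in \<open>simp_all add: D3\<close>)
  qed (use N_pos in simp_all)
  also have "\<dots> = 15 * (N * expectation (\<lambda>\<omega>. \<bar>D \<omega>\<bar> ^ 3)) + 4 * \<gamma> * (N * expectation (\<lambda>\<omega>. (D \<omega>)\<^sup>2))"
    by (simp add: algebra_simps)
  \<comment> \<open>The third moment carries 7 + 4 * 2 = 15, where 4 is the constant of
    \<open>stein_solution_taylor\<close>; the variance carries the other 4.\<close>
  also have "\<dots> \<le> 19 * \<gamma>" using third_D by (simp add: var_D)
  finally show ?thesis using 1 p unfolding p_def by linarith
qed

end

section \<open>The Berry--Esseen theorem for i.i.d. summands\<close>

lemma (in prob_space) indep_var_swap:
  assumes "indep_var S X T Y"
  shows "indep_var T Y S X"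
proof -
  have "indep_set B A" if "indep_set A B" for A B
    unfolding indep_sets2_eq
  proof (intro conjI ballI)
    fix b a assume "b \<in> B" "a \<in> A"
    then have "prob (a \<inter> b) = prob a * prob b" using that unfolding indep_sets2_eq by blast
    then show "prob (b \<inter> a) = prob b * prob a" by (simp only: Int_commute mult.commute)
  qed (use that in \<open>auto simp: indep_sets2_eq\<close>)
  then show ?thesis using assms unfolding indep_var_eq by blast
qed

text \<open>The characteristic function of such a sum is a power of the common one, with the number
  of summands as exponent, so Levy's uniqueness theorem applies. This replaces a permutation
  argument for exchangeability.\<close>

lemma (in prob_space) distr_sum_iid_eq:
  fixes Z :: "'i \<Rightarrow> 'a \<Rightarrow> real"
  assumes ind: "indep_vars (\<lambda>_. borel) Z I" and "A \<subseteq> I" "B \<subseteq> I" "card A = card B"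
    and distr: "\<And>i. i \<in> I \<Longrightarrow> distr M borel (Z i) = \<mu>"
  shows "distr M borel (\<lambda>\<omega>. \<Sum>i\<in>A. Z i \<omega>) = distr M borel (\<lambda>\<omega>. \<Sum>i\<in>B. Z i \<omega>)"
proof -
  have rv: "Z i \<in> borel_measurable M" if "i \<in> I" for i
    using ind that by (auto simp: indep_vars_def)
  have char: "char (distr M borel (\<lambda>\<omega>. \<Sum>i\<in>C. Z i \<omega>)) t = char \<mu> t ^ card C" if "C \<subseteq> I" for C t
  proof -
    have "char (distr M borel (\<lambda>\<omega>. \<Sum>i\<in>C. Z i \<omega>)) t = (\<Prod>i\<in>C. char (distr M borel (Z i)) t)"
      by (rule char_distr_sum[OF indep_vars_subset[OF ind that]])
    also have "\<dots> = (\<Prod>i\<in>C. char \<mu> t)"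
      using that by (intro prod.cong) (auto simp: distr)
    finally show ?thesis by simp
  qed
  show ?thesis
  proof (rule Levy_uniqueness)
    show "real_distribution (distr M borel (\<lambda>\<omega>. \<Sum>i\<in>A. Z i \<omega>))"
      using rv assms(2) by (intro real_distribution_distr borel_measurable_sum) auto
    show "real_distribution (distr M borel (\<lambda>\<omega>. \<Sum>i\<in>B. Z i \<omega>))"
      using rv assms(3) by (intro real_distribution_distr borel_measurable_sum) auto
    show "char (distr M borel (\<lambda>\<omega>. \<Sum>i\<in>A. Z i \<omega>)) = char (distr M borel (\<lambda>\<omega>. \<Sum>i\<in>B. Z i \<omega>))"
      using assms(2-4) by (simp add: fun_eq_iff char)
  qed
qed

text \<open>The three claims are proved in one induction: the cross term of the squared sum is
  integrable and has mean zero by independence, which uses the other two claims for the smaller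
  sum.\<close>

lemma (in prob_space) sum_indep_second_moment:
  fixes Z :: "'i \<Rightarrow> 'a \<Rightarrow> real" and s :: real
  assumes ind: "indep_vars (\<lambda>_. borel) Z A" and "finite A"
    and int: "\<And>i. i \<in> A \<Longrightarrow> integrable M (\<lambda>\<omega>. (Z i \<omega>)\<^sup>2)"
    and mean: "\<And>i. i \<in> A \<Longrightarrow> expectation (Z i) = 0"
    and var: "\<And>i. i \<in> A \<Longrightarrow> expectation (\<lambda>\<omega>. (Z i \<omega>)\<^sup>2) = s"
  shows "integrable M (\<lambda>\<omega>. (\<Sum>i\<in>A. Z i \<omega>)\<^sup>2)" (is ?P)
    and "expectation (\<lambda>\<omega>. \<Sum>i\<in>A. Z i \<omega>) = 0" (is ?Q)
    and "expectation (\<lambda>\<omega>. (\<Sum>i\<in>A. Z i \<omega>)\<^sup>2) = card A * s" (is ?R)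
proof -
  have "?P \<and> ?Q \<and> ?R"
    using assms(2,1,3-5)
  proof (induction A rule: finite_induct)
    case (insert i A)
    let ?S = "\<lambda>\<omega>. \<Sum>i\<in>A. Z i \<omega>"
    have IH: "integrable M (\<lambda>\<omega>. (?S \<omega>)\<^sup>2)" "expectation ?S = 0" "expectation (\<lambda>\<omega>. (?S \<omega>)\<^sup>2) = card A * s"
      using insert.IH insert.prems indep_vars_subset[OF insert.prems(1), of A] by auto
    have iv: "indep_var borel (Z i) borel ?S"
      using insert by (intro indep_vars_sum) auto
    then have [measurable]: "Z i \<in> borel_measurable M" "?S \<in> borel_measurable M"
      by (auto dest: indep_var_rv1 indep_var_rv2)
    have int_Z: "integrable M (Z i)"
      by (rule square_integrable_imp_integrable) (use insert.prems in auto)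
    have int_S: "integrable M ?S"
      by (rule square_integrable_imp_integrable) (use IH in auto)
    have int_ZS: "integrable M (\<lambda>\<omega>. Z i \<omega> * ?S \<omega>)" and E_ZS: "expectation (\<lambda>\<omega>. Z i \<omega> * ?S \<omega>) = 0"
      using indep_var_lebesgue_integral[OF iv int_Z int_S] indep_var_integrable[OF iv int_Z int_S] IH(2)
      by simp_all
    have eq: "(\<Sum>i\<in>insert i A. Z i \<omega>)\<^sup>2 = (Z i \<omega>)\<^sup>2 + (?S \<omega>)\<^sup>2 + 2 * (Z i \<omega> * ?S \<omega>)" for \<omega>
      using insert.hyps by (simp add: power2_sum)
    have int_Z2: "integrable M (\<lambda>\<omega>. (Z i \<omega>)\<^sup>2)" "expectation (\<lambda>\<omega>. (Z i \<omega>)\<^sup>2) = s" "expectation (Z i) = 0"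
      using insert.prems by auto
    have "integrable M (\<lambda>\<omega>. (\<Sum>i\<in>insert i A. Z i \<omega>)\<^sup>2)"
      unfolding eq using int_Z2(1) IH(1) int_ZS by simp
    moreover have "expectation (\<lambda>\<omega>. \<Sum>i\<in>insert i A. Z i \<omega>) = 0"
      using insert.hyps int_Z int_S IH(2) int_Z2(3) by simp
    moreover have "expectation (\<lambda>\<omega>. (\<Sum>i\<in>insert i A. Z i \<omega>)\<^sup>2) = card (insert i A) * s"
    proof -
      have "expectation (\<lambda>\<omega>. (\<Sum>i\<in>insert i A. Z i \<omega>)\<^sup>2)
        = expectation (\<lambda>\<omega>. (Z i \<omega>)\<^sup>2) + expectation (\<lambda>\<omega>. (?S \<omega>)\<^sup>2) + 2 * expectation (\<lambda>\<omega>. Z i \<omega> * ?S \<omega>)"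
        unfolding eq using int_Z2(1) IH(1) int_ZS by simp
      also have "\<dots> = card (insert i A) * s"
        using insert.hyps by (simp add: int_Z2(2) IH(3) E_ZS algebra_simps)
      finally show ?thesis .
    qed
    ultimately show ?case by blast
  qed simp
  then show ?P ?Q ?R by auto
qed

lemma (in prob_space) expectation_abs_le_one:
  fixes S :: "'a \<Rightarrow> real"
  assumes "S \<in> borel_measurable M" "integrable M (\<lambda>\<omega>. (S \<omega>)\<^sup>2)" "expectation (\<lambda>\<omega>. (S \<omega>)\<^sup>2) \<le> 1"
  shows "expectation (\<lambda>\<omega>. \<bar>S \<omega>\<bar>) \<le> 1"
proof -
  have "integrable M S" by (rule square_integrable_imp_integrable[OF assms(1,2)])
  have "expectation (\<lambda>\<omega>. \<bar>S \<omega>\<bar>) \<le> expectation (\<lambda>\<omega>. (1 + (S \<omega>)\<^sup>2) / 2)"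
  proof (rule integral_mono)
    fix \<omega>
    have "0 \<le> (\<bar>S \<omega>\<bar> - 1)\<^sup>2" by simp
    then show "\<bar>S \<omega>\<bar> \<le> (1 + (S \<omega>)\<^sup>2) / 2" by (simp add: power2_diff)
  qed (use assms \<open>integrable M S\<close> in auto)
  also have "\<dots> \<le> 1" using assms by (simp add: prob_space)
  finally show ?thesis .
qed

text \<open>Exchangeability: each pair \<open>(S - Z i, Z i)\<close> has the same law, so the summands of
  \<open>E (S f(S))\<close> coincide.\<close>

lemma (in prob_space) iid_sum_stein_identity:
  fixes Z :: "'i \<Rightarrow> 'a \<Rightarrow> real" and f :: "real \<Rightarrow> real"
  assumes ind: "indep_vars (\<lambda>_. borel) Z A" and fin: "finite A" and "k \<in> A"
    and distr: "\<And>i. i \<in> A \<Longrightarrow> distr M borel (Z i) = \<mu>"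
    and int: "\<And>i. i \<in> A \<Longrightarrow> integrable M (Z i)"
    and [measurable]: "f \<in> borel_measurable borel" and bound: "\<And>x. \<bar>f x\<bar> \<le> B"
  shows "expectation (\<lambda>\<omega>. (\<Sum>i\<in>A. Z i \<omega>) * f (\<Sum>i\<in>A. Z i \<omega>))
    = card A * expectation (\<lambda>\<omega>. Z k \<omega> * f (\<Sum>i\<in>A. Z i \<omega>))"
proof -
  have rv: "Z i \<in> borel_measurable M" if "i \<in> A" for i
    using ind that by (auto simp: indep_vars_def)
  then have [measurable]: "(\<lambda>\<omega>. \<Sum>i\<in>A. Z i \<omega>) \<in> borel_measurable M" by simp
  have intf: "integrable M (\<lambda>\<omega>. Z i \<omega> * f (\<Sum>i\<in>A. Z i \<omega>))" if "i \<in> A" for i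
    by (rule integrable_mult_bounded[OF int[OF that] _ bound]) simp
  \<comment> \<open>The right-hand side mentions the fixed \<open>k\<close> but not
    \<open>i\<close>, so all summands share this value.\<close>
  have eq: "expectation (\<lambda>\<omega>. Z i \<omega> * f (\<Sum>i\<in>A. Z i \<omega>)) =
    (\<integral>(z, v). z * f (z + v) \<partial>(\<mu> \<Otimes>\<^sub>M distr M borel (\<lambda>\<omega>. \<Sum>j\<in>A - {k}. Z j \<omega>)))" if i: "i \<in> A" for i
  proof -
    have [measurable]: "Z i \<in> borel_measurable M" by (rule rv[OF i])
    have [measurable]: "(\<lambda>\<omega>. \<Sum>j\<in>A - {i}. Z j \<omega>) \<in> borel_measurable M"
      by (intro borel_measurable_sum rv) auto
    have "indep_var borel (Z i) borel (\<lambda>\<omega>. \<Sum>j\<in>A - {i}. Z j \<omega>)"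
      by (rule indep_vars_sum) (use fin ind i in \<open>auto simp: insert_absorb\<close>)
    then have "distr M (borel \<Otimes>\<^sub>M borel) (\<lambda>\<omega>. (Z i \<omega>, \<Sum>j\<in>A - {i}. Z j \<omega>))
      = distr M borel (Z i) \<Otimes>\<^sub>M distr M borel (\<lambda>\<omega>. \<Sum>j\<in>A - {i}. Z j \<omega>)"
      by (simp add: indep_var_distribution_eq)
    also have "distr M borel (\<lambda>\<omega>. \<Sum>j\<in>A - {i}. Z j \<omega>) = distr M borel (\<lambda>\<omega>. \<Sum>j\<in>A - {k}. Z j \<omega>)"
      by (rule distr_sum_iid_eq[OF ind _ _ _ distr]) (use i \<open>k \<in> A\<close> fin in auto)
    also note distr[OF i]
    finally have joint: "\<mu> \<Otimes>\<^sub>M distr M borel (\<lambda>\<omega>. \<Sum>j\<in>A - {k}. Z j \<omega>)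
      = distr M (borel \<Otimes>\<^sub>M borel) (\<lambda>\<omega>. (Z i \<omega>, \<Sum>j\<in>A - {i}. Z j \<omega>))" ..
    show ?thesis
      unfolding joint by (subst integral_distr) (auto simp: sum.remove[OF fin i])
  qed
  have "expectation (\<lambda>\<omega>. (\<Sum>i\<in>A. Z i \<omega>) * f (\<Sum>i\<in>A. Z i \<omega>))
    = (\<Sum>i\<in>A. expectation (\<lambda>\<omega>. Z i \<omega> * f (\<Sum>i\<in>A. Z i \<omega>)))"
    unfolding sum_distrib_right by (rule Bochner_Integration.integral_sum[OF intf])
  also have "\<dots> = (\<Sum>i\<in>A. expectation (\<lambda>\<omega>. Z k \<omega> * f (\<Sum>i\<in>A. Z i \<omega>)))"
    by (rule sum.cong) (simp_all only: eq eq[OF \<open>k \<in> A\<close>])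
  finally show ?thesis by simp
qed

text \<open>\<open>normal_approximation\<close> is applied to the summands divided by sqrt n, with
  the last one as \<open>D\<close>. The mean of |D| is at most 1 / sqrt n, so the constant is 9 + 20
  (\<rho> + 1) = 29 + 20 \<rho>.\<close>

theorem (in prob_space) berry_esseen_iid:
  fixes Z :: "nat \<Rightarrow> 'a \<Rightarrow> real"
  assumes ind: "indep_vars (\<lambda>_. borel) Z {1..n}" and n: "n \<ge> 1"
    and distr: "\<And>i. i \<in> {1..n} \<Longrightarrow> distr M borel (Z i) = \<mu>"
    and int2: "integrable \<mu> (\<lambda>x. x\<^sup>2)" and int3: "integrable \<mu> (\<lambda>x. \<bar>x\<bar> ^ 3)"
    and mean: "(\<integral>x. x \<partial>\<mu>) = 0" and var: "(\<integral>x. x\<^sup>2 \<partial>\<mu>) = 1"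
  shows "\<bar>prob {\<omega> \<in> space M. (\<Sum>i=1..n. Z i \<omega>) / sqrt n \<le> z} - \<Phi> z\<bar>
    \<le> (29 + 20 * (\<integral>x. \<bar>x\<bar> ^ 3 \<partial>\<mu>)) / sqrt n"
proof -
  define \<rho> where "\<rho> = (\<integral>x. \<bar>x\<bar> ^ 3 \<partial>\<mu>)"
  have \<rho>: "0 \<le> \<rho>" unfolding \<rho>_def by simp
  define Z' where "Z' = (\<lambda>i \<omega>. Z i \<omega> / sqrt n)"
  have rv [measurable]: "Z i \<in> borel_measurable M" if "i \<in> {1..n}" for i
    using ind that by (auto simp: indep_vars_def)
  have moments: "integrable M (\<lambda>\<omega>. (Z i \<omega>)\<^sup>2)" "integrable M (\<lambda>\<omega>. \<bar>Z i \<omega>\<bar> ^ 3)"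
    "expectation (Z i) = 0" "expectation (\<lambda>\<omega>. (Z i \<omega>)\<^sup>2) = 1" "expectation (\<lambda>\<omega>. \<bar>Z i \<omega>\<bar> ^ 3) = \<rho>"
    if i: "i \<in> {1..n}" for i
    using int2 int3 mean var rv[OF i] unfolding \<rho>_def distr[OF i, symmetric]
    by (simp_all add: integrable_distr_eq integral_distr)
  have int: "integrable M (Z i)" if "i \<in> {1..n}" for i
    by (rule square_integrable_imp_integrable[OF rv[OF that] moments(1)[OF that]])
  have ind': "indep_vars (\<lambda>_. borel) Z' {1..n}"
    unfolding Z'_def by (rule indep_vars_compose2[OF ind]) measurable
  have distr': "distr M borel (Z' i) = distr \<mu> borel (\<lambda>x. x / sqrt n)" if "i \<in> {1..n}" for i
    unfolding Z'_def distr[OF that, symmetric] using rv[OF that] by (subst distr_distr) (auto simp: comp_def)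
  have second: "integrable M (\<lambda>\<omega>. (Z' i \<omega>)\<^sup>2)" "expectation (Z' i) = 0" "expectation (\<lambda>\<omega>. (Z' i \<omega>)\<^sup>2) = 1 / n"
    if "i \<in> {1..n}" for i
    using moments[OF that] by (simp_all add: Z'_def power_divide)
  \<comment> \<open>Arbitrary index sets cover both the full sum and the sum without its last
    term.\<close>
  have abs_sum: "expectation (\<lambda>\<omega>. \<bar>\<Sum>i\<in>A. Z' i \<omega>\<bar>) \<le> 1" if A: "A \<subseteq> {1..n}" for A
  proof (rule expectation_abs_le_one)
    have "finite A" using A finite_subset by blast
    note s = sum_indep_second_moment[where s = "1 / real n", OF indep_vars_subset[OF ind' A] this]
    show "integrable M (\<lambda>\<omega>. (\<Sum>i\<in>A. Z' i \<omega>)\<^sup>2)"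
      by (rule s(1)) (use A second in blast)+
    have "expectation (\<lambda>\<omega>. (\<Sum>i\<in>A. Z' i \<omega>)\<^sup>2) = card A * (1 / n)"
      by (rule s(3)) (use A second in blast)+
    also have "card A \<le> n" using card_mono[OF _ A] by simp
    then have "card A * (1 / n) \<le> 1" using n by (simp add: field_simps)
    finally show "expectation (\<lambda>\<omega>. (\<Sum>i\<in>A. Z' i \<omega>)\<^sup>2) \<le> 1" .
    show "(\<lambda>\<omega>. \<Sum>i\<in>A. Z' i \<omega>) \<in> borel_measurable M"
      using A unfolding Z'_def by (intro borel_measurable_sum borel_measurable_divide rv) auto
  qed
  have nn: "n \<in> {1..n}" using n by simp
  have sum_n: "(\<Sum>i\<in>{1..n} - {n}. Z' i \<omega>) + Z' n \<omega> = (\<Sum>i\<in>{1..n}. Z' i \<omega>)" for \<omega>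
    using sum.remove[of "{1..n}" n "\<lambda>i. Z' i \<omega>"] nn by simp
  have int': "integrable M (Z' i)" if "i \<in> {1..n}" for i
    using int[OF that] by (simp add: Z'_def)
  \<comment> \<open>The 1 added to \<rho> makes the last parameter strictly positive from \<rho>
    \<ge> 0 alone.\<close>
  interpret stein_pair M "\<lambda>\<omega>. \<Sum>i\<in>{1..n} - {n}. Z' i \<omega>" "Z' n" "real n" "(\<rho> + 1) / sqrt n"
  proof unfold_locales
    have "indep_var borel (Z' n) borel (\<lambda>\<omega>. \<Sum>j\<in>{1..n} - {n}. Z' j \<omega>)"
      by (rule indep_vars_sum) (use ind' nn in \<open>auto simp: insert_absorb\<close>)
    then show "indep_var borel (\<lambda>\<omega>. \<Sum>j\<in>{1..n} - {n}. Z' j \<omega>) borel (Z' n)"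
      by (rule indep_var_swap)
    show "integrable M (\<lambda>\<omega>. \<Sum>i\<in>{1..n} - {n}. Z' i \<omega>)"
      by (intro Bochner_Integration.integrable_sum int') auto
    show "integrable M (\<lambda>\<omega>. (Z' n \<omega>)\<^sup>2)" "expectation (Z' n) = 0" by (rule second[OF nn])+
    show "integrable M (\<lambda>\<omega>. \<bar>Z' n \<omega>\<bar> ^ 3)"
      using moments(2)[OF nn] by (simp add: Z'_def power_divide)
    show "real n * expectation (\<lambda>\<omega>. (Z' n \<omega>)\<^sup>2) = 1"
      using second(3)[OF nn] n by simp
    have "real n * expectation (\<lambda>\<omega>. \<bar>Z' n \<omega>\<bar> ^ 3) = real n * (\<rho> / sqrt n ^ 3)"
      using moments(5)[OF nn] by (simp add: Z'_def power_divide)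
    also have "\<dots> = \<rho> / sqrt n"
      using n by (simp add: power3_eq_cube field_simps)
    also have "\<dots> \<le> (\<rho> + 1) / sqrt n" by (simp add: divide_right_mono)
    finally show "real n * expectation (\<lambda>\<omega>. \<bar>Z' n \<omega>\<bar> ^ 3) \<le> (\<rho> + 1) / sqrt n" .
    show "0 < real n" using n by simp
    then show "0 < (\<rho> + 1) / sqrt n" using \<rho> by simp
    show "expectation (\<lambda>\<omega>. \<bar>\<Sum>i\<in>{1..n} - {n}. Z' i \<omega>\<bar>) \<le> 1" by (rule abs_sum) auto
    show "expectation (\<lambda>\<omega>. \<bar>(\<Sum>i\<in>{1..n} - {n}. Z' i \<omega>) + Z' n \<omega>\<bar>) \<le> 1"
      unfolding sum_n by (rule abs_sum) auto
    show "expectation (\<lambda>\<omega>. ((\<Sum>i\<in>{1..n} - {n}. Z' i \<omega>) + Z' n \<omega>) * f ((\<Sum>i\<in>{1..n} - {n}. Z' i \<omega>) + Z' n \<omega>))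
      = real n * expectation (\<lambda>\<omega>. Z' n \<omega> * f ((\<Sum>i\<in>{1..n} - {n}. Z' i \<omega>) + Z' n \<omega>))"
      if "f \<in> borel_measurable borel" "\<And>x. \<bar>f x\<bar> \<le> B" for f B
      unfolding sum_n
      using iid_sum_stein_identity[OF ind' _ nn distr' int' that] by simp
  qed
  have "expectation (\<lambda>\<omega>. \<bar>Z n \<omega>\<bar>) \<le> 1"
    by (rule expectation_abs_le_one) (use rv[OF nn] moments[OF nn] in auto)
  then have "expectation (\<lambda>\<omega>. \<bar>Z' n \<omega>\<bar>) \<le> 1 / sqrt n"
    by (simp add: Z'_def divide_right_mono)
  moreover have "(\<Sum>i\<in>{1..n}. Z' i \<omega>) = (\<Sum>i=1..n. Z i \<omega>) / sqrt n" for \<omega>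
    by (simp add: Z'_def sum_divide_distrib)
  moreover have "9 * (1 / sqrt n) + 20 * ((\<rho> + 1) / sqrt n) = (29 + 20 * \<rho>) / sqrt n"
    by (simp add: add_divide_distrib)
  ultimately show ?thesis
    using normal_approximation[of z] unfolding sum_n \<rho>_def by simp
qed

section \<open>Adding observations to a sample\<close>

text \<open>Given U = u the event is T \<le> a + u, with probability within \<epsilon> of \<Phi> (a
  + u). Averaging over U then leaves only the quadratic Taylor remainder, as U is centred.\<close>

lemma (in prob_space) normal_approximation_perturbed:
  fixes T U :: "'a \<Rightarrow> real"
  assumes ind: "indep_var borel T borel U"
    and approx: "\<And>t. \<bar>prob {\<omega> \<in> space M. T \<omega> \<le> t} - \<Phi> t\<bar> \<le> \<epsilon>"
    and int: "integrable M (\<lambda>\<omega>. (U \<omega>)\<^sup>2)" and mean: "expectation U = 0"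
  shows "\<bar>prob {\<omega> \<in> space M. T \<omega> - U \<omega> \<le> a} - \<Phi> a\<bar> \<le> \<epsilon> + expectation (\<lambda>\<omega>. (U \<omega>)\<^sup>2)"
proof -
  have [measurable]: "T \<in> borel_measurable M" "U \<in> borel_measurable M"
    using ind by (auto dest: indep_var_rv1 indep_var_rv2)
  have intU: "integrable M U" by (rule square_integrable_imp_integrable[OF _ int]) simp
  let ?I = "\<lambda>t u. if t \<le> a + u then 1 else 0 :: real"
  have prob: "prob {\<omega> \<in> space M. T \<omega> \<le> a + u \<omega>} = expectation (\<lambda>\<omega>. ?I (T \<omega>) (u \<omega>))"
    if [measurable]: "u \<in> borel_measurable M" for u
  proof -
    have "expectation (\<lambda>\<omega>. ?I (T \<omega>) (u \<omega>)) = expectation (indicator {\<omega> \<in> space M. T \<omega> \<le> a + u \<omega>})"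
      by (rule Bochner_Integration.integral_cong) (auto simp: indicator_def)
    then show ?thesis by (simp add: Int_def conj_ac)
  qed
  have intI: "integrable M (\<lambda>\<omega>. ?I (T \<omega>) (U \<omega>))"
    by (rule integrable_const_bound[of _ 1]) auto
  have int\<Phi>: "integrable M (\<lambda>\<omega>. \<Phi> (a + U \<omega>))"
    by (rule integrable_const_bound[of _ 1]) (auto simp: std_normal_cdf_nonneg std_normal_cdf_le_1)
  have le: "\<bar>expectation (\<lambda>\<omega>. ?I (T \<omega>) u) - \<Phi> (a + u)\<bar> \<le> \<epsilon>" for u
    using approx[of "a + u"] prob[of "\<lambda>_. u"] by simp
  have "expectation (\<lambda>\<omega>. ?I (T \<omega>) (U \<omega>)) \<le> expectation (\<lambda>\<omega>. \<Phi> (a + U \<omega>) + \<epsilon>)"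
    by (rule indep_var_expectation_le[OF ind, where f = ?I and g = "\<lambda>u. \<Phi> (a + u) + \<epsilon>"])
       (use intI int\<Phi> le in \<open>auto simp: abs_le_iff diff_le_eq algebra_simps\<close>)
  \<comment> \<open>\<open>indep_var_expectation_le\<close> is one-sided; the negated indicator
    gives the lower bound.\<close>
  moreover have "expectation (\<lambda>\<omega>. - ?I (T \<omega>) (U \<omega>)) \<le> expectation (\<lambda>\<omega>. \<epsilon> - \<Phi> (a + U \<omega>))"
    by (rule indep_var_expectation_le[OF ind, where f = "\<lambda>t u. - ?I t u" and g = "\<lambda>u. \<epsilon> - \<Phi> (a + u)"])
       (use intI int\<Phi> le in \<open>auto simp: abs_le_iff diff_le_eq algebra_simps\<close>)
  ultimately have 1: "\<bar>expectation (\<lambda>\<omega>. ?I (T \<omega>) (U \<omega>)) - expectation (\<lambda>\<omega>. \<Phi> (a + U \<omega>))\<bar> \<le> \<epsilon>"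
    using intI int\<Phi> by (simp add: prob_space abs_le_iff)
  have "expectation (\<lambda>\<omega>. \<Phi> (a + U \<omega>)) - \<Phi> a
      = expectation (\<lambda>\<omega>. \<Phi> (a + U \<omega>) - \<Phi> a - U \<omega> * std_normal_density a)"
    using int\<Phi> intU mean by (simp add: prob_space)
  also have "\<bar>\<dots>\<bar> \<le> expectation (\<lambda>\<omega>. (U \<omega>)\<^sup>2)"
    by (intro order_trans[OF integral_abs_bound] integral_mono std_normal_cdf_taylor)
       (use int\<Phi> intU int in auto)
  finally have 2: "\<bar>expectation (\<lambda>\<omega>. \<Phi> (a + U \<omega>)) - \<Phi> a\<bar> \<le> expectation (\<lambda>\<omega>. (U \<omega>)\<^sup>2)" .
  have "prob {\<omega> \<in> space M. T \<omega> - U \<omega> \<le> a} = expectation (\<lambda>\<omega>. ?I (T \<omega>) (U \<omega>))"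
    using prob[of U] by (simp add: diff_le_eq)
  then show ?thesis using 1 2 by linarith
qed

lemma (in prob_space) iid_with_df_distr_eq:
  assumes "iid_with_df M Z F" "i \<ge> 1" "j \<ge> 1"
  shows "distr M borel (Z i) = distr M borel (Z j)"
proof -
  have rv: "Z i \<in> borel_measurable M" if "i \<ge> 1" for i
    using assms(1) that by (auto simp: iid_with_df_def indep_vars_def)
  show ?thesis
    by (rule cdf_unique)
       (use assms rv in \<open>auto simp: iid_with_df_def distribution_function_def\<close>)
qed

text \<open>The definition asks for a positive constant; passing to |C| + 1 allows any real
  C.\<close>

lemma bigo_uniformly_onI:
  assumes "eventually (\<lambda>n. \<forall>x\<in>S. \<bar>f n x\<bar> \<le> C * g n) sequentially" "\<And>n. 0 \<le> g n"
  shows "bigo_uniformly_on S f g"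
  unfolding bigo_uniformly_on_def
proof (intro exI conjI)
  show "0 < \<bar>C\<bar> + 1" by simp
  show "eventually (\<lambda>n. \<forall>x\<in>S. \<bar>f n x\<bar> \<le> (\<bar>C\<bar> + 1) * \<bar>g n\<bar>) sequentially"
    using assms(1)
  proof eventually_elim
    case (elim n)
    have "C * g n \<le> (\<bar>C\<bar> + 1) * \<bar>g n\<bar>"
      using assms(2)[of n] by (simp add: mult_right_mono)
    then show ?case using elim by fastforce
  qed
qed

text \<open>A non-asymptotic form of the first claim: one constant serves all sample sizes and all
  x, so the growth of \<open>k\<close> enters only when the two error terms are compared with the
  rate.\<close>

lemma (in prob_space) Delta_add_normal_approximation:
  fixes X Y :: "nat \<Rightarrow> 'a \<Rightarrow> real"
  assumes X: "iid_with_df M X F\<^sub>0" and Y: "iid_with_df M Y F\<^sub>1" and XY: "indep_sequences M X Y"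
    and X1: "integrable M (X 1)" "expectation (X 1) = \<mu>\<^sub>0"
      "integrable M (\<lambda>\<omega>. (X 1 \<omega>)\<^sup>2)" "variance (X 1) = \<sigma>\<^sub>0\<^sup>2"
    and Y1: "integrable M (Y 1)" "expectation (Y 1) = \<mu>\<^sub>1"
      "integrable M (\<lambda>\<omega>. (Y 1 \<omega>)\<^sup>2)" "variance (Y 1) = \<sigma>\<^sub>1\<^sup>2" "integrable M (\<lambda>\<omega>. \<bar>Y 1 \<omega>\<bar> ^ 3)"
    and \<sigma>\<^sub>1: "\<sigma>\<^sub>1 > 0"
  obtains C where "\<And>n k x. n \<ge> 1 \<Longrightarrow> k \<ge> 1 \<Longrightarrow>
    \<bar>distribution_function M (Delta_add X Y n k) (sqrt k * \<sigma>\<^sub>1 * x / n)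
       - \<Phi> (x - real n / (real n + real k) * (sqrt k * (\<mu>\<^sub>1 - \<mu>\<^sub>0) / \<sigma>\<^sub>1))\<bar>
     \<le> C * (1 / sqrt k + k / n)"
proof -
  have rvX: "X i \<in> borel_measurable M" and rvY: "Y i \<in> borel_measurable M" if "i \<ge> 1" for i
    using X Y that by (auto simp: iid_with_df_def indep_vars_def)
  define X' where "X' = (\<lambda>i \<omega>. X i \<omega> - \<mu>\<^sub>0)"
  define Z where "Z = (\<lambda>j \<omega>. (Y j \<omega> - \<mu>\<^sub>1) / \<sigma>\<^sub>1)"
  define \<mu> where "\<mu> = distr M borel (Z 1)"
  have rvZ: "Z i \<in> borel_measurable M" if "i \<ge> 1" for i
    using rvY[OF that] by (simp add: Z_def)
  have distrZ: "distr M borel (Z i) = \<mu>" if i: "i \<ge> 1" for i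
  proof -
    have "distr M borel (Z i) = distr (distr M borel (Y i)) borel (\<lambda>y. (y - \<mu>\<^sub>1) / \<sigma>\<^sub>1)" if "i \<ge> 1" for i
      using rvY[OF that] by (subst distr_distr) (auto simp: Z_def comp_def)
    then show ?thesis
      using iid_with_df_distr_eq[OF Y i, of 1] i by (simp add: \<mu>_def)
  qed
  have indX: "indep_vars (\<lambda>_. borel) X' {1..n}" and indZ: "indep_vars (\<lambda>_. borel) Z {1..n}" for n
  proof -
    have "indep_vars (\<lambda>_. borel) X {1..n}" and indY: "indep_vars (\<lambda>_. borel) Y {1..n}"
      using X Y by (auto simp: iid_with_df_def intro: indep_vars_subset[of _ _ "{1..}"])
    then show "indep_vars (\<lambda>_. borel) X' {1..n}"
      unfolding X'_def by (rule_tac indep_vars_compose2) measurable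
    from indY show "indep_vars (\<lambda>_. borel) Z {1..n}"
      unfolding Z_def by (rule indep_vars_compose2) measurable
  qed
  have Z1: "integrable \<mu> (\<lambda>x. x\<^sup>2)" "integrable \<mu> (\<lambda>x. \<bar>x\<bar> ^ 3)" "(\<integral>x. x \<partial>\<mu>) = 0" "(\<integral>x. x\<^sup>2 \<partial>\<mu>) = 1"
  proof -
    have [measurable]: "Z 1 \<in> borel_measurable M" "Y 1 \<in> borel_measurable M" using rvZ rvY by auto
    show "integrable \<mu> (\<lambda>x. x\<^sup>2)" unfolding \<mu>_def
      using Y1 by (subst integrable_distr_eq) (auto simp: Z_def power_divide power2_diff)
    show "(\<integral>x. x \<partial>\<mu>) = 0" unfolding \<mu>_def
      using Y1 by (subst integral_distr) (auto simp: Z_def prob_space)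
    show "(\<integral>x. x\<^sup>2 \<partial>\<mu>) = 1" unfolding \<mu>_def
      using Y1 \<sigma>\<^sub>1 by (subst integral_distr) (auto simp: Z_def power_divide)
    have "integrable M (\<lambda>\<omega>. 8 * (\<bar>Y 1 \<omega>\<bar> ^ 3 + \<bar>\<mu>\<^sub>1\<bar> ^ 3) / \<sigma>\<^sub>1 ^ 3)" using Y1 by simp
    then have "integrable M (\<lambda>\<omega>. \<bar>Z 1 \<omega>\<bar> ^ 3)"
    proof (rule Bochner_Integration.integrable_bound)
      show "AE \<omega> in M. norm (\<bar>Z 1 \<omega>\<bar> ^ 3) \<le> norm (8 * (\<bar>Y 1 \<omega>\<bar> ^ 3 + \<bar>\<mu>\<^sub>1\<bar> ^ 3) / \<sigma>\<^sub>1 ^ 3)"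
      proof (rule AE_I2)
        fix \<omega>
        have "\<bar>Y 1 \<omega> - \<mu>\<^sub>1\<bar> \<le> 2 * max \<bar>Y 1 \<omega>\<bar> \<bar>\<mu>\<^sub>1\<bar>" by auto
        then have "\<bar>Y 1 \<omega> - \<mu>\<^sub>1\<bar> ^ 3 \<le> (2 * max \<bar>Y 1 \<omega>\<bar> \<bar>\<mu>\<^sub>1\<bar>) ^ 3" by (rule power_mono) simp
        also have "\<dots> \<le> 8 * (\<bar>Y 1 \<omega>\<bar> ^ 3 + \<bar>\<mu>\<^sub>1\<bar> ^ 3)"
          by (cases "\<bar>Y 1 \<omega>\<bar> \<le> \<bar>\<mu>\<^sub>1\<bar>") (auto simp: power_mult_distrib max_def)
        finally have "\<bar>Y 1 \<omega> - \<mu>\<^sub>1\<bar> ^ 3 / \<sigma>\<^sub>1 ^ 3 \<le> 8 * (\<bar>Y 1 \<omega>\<bar> ^ 3 + \<bar>\<mu>\<^sub>1\<bar> ^ 3) / \<sigma>\<^sub>1 ^ 3"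
          using \<sigma>\<^sub>1 by (intro divide_right_mono) auto
        moreover have "norm (\<bar>Z 1 \<omega>\<bar> ^ 3) = \<bar>Y 1 \<omega> - \<mu>\<^sub>1\<bar> ^ 3 / \<sigma>\<^sub>1 ^ 3"
          using \<sigma>\<^sub>1 by (simp add: Z_def power_divide abs_divide)
        ultimately show "norm (\<bar>Z 1 \<omega>\<bar> ^ 3) \<le> norm (8 * (\<bar>Y 1 \<omega>\<bar> ^ 3 + \<bar>\<mu>\<^sub>1\<bar> ^ 3) / \<sigma>\<^sub>1 ^ 3)"
          by (metis abs_ge_self order_trans real_norm_def)
      qed
    qed measurable
    then show "integrable \<mu> (\<lambda>x. \<bar>x\<bar> ^ 3)" unfolding \<mu>_def using rvZ[of 1] by (subst integrable_distr_eq) auto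
  qed
  have X2: "integrable M (\<lambda>\<omega>. (X' i \<omega>)\<^sup>2)" "expectation (X' i) = 0" "expectation (\<lambda>\<omega>. (X' i \<omega>)\<^sup>2) = \<sigma>\<^sub>0\<^sup>2"
    if i: "i \<ge> 1" for i
  proof -
    have [measurable]: "X i \<in> borel_measurable M" "X 1 \<in> borel_measurable M" using rvX i by auto
    have eq: "distr M borel (X i) = distr M borel (X 1)" by (rule iid_with_df_distr_eq[OF X i]) simp
    have *: "integrable M (\<lambda>\<omega>. f (X i \<omega>)) = integrable M (\<lambda>\<omega>. f (X 1 \<omega>))"
      "expectation (\<lambda>\<omega>. f (X i \<omega>)) = expectation (\<lambda>\<omega>. f (X 1 \<omega>))"
      if [measurable]: "f \<in> borel_measurable borel" for f :: "real \<Rightarrow> real"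
      using integrable_distr_eq[of "X i" M borel f] integrable_distr_eq[of "X 1" M borel f]
        integral_distr[of "X i" M borel f] integral_distr[of "X 1" M borel f] eq i rvX[of 1]
      by simp_all
    show "integrable M (\<lambda>\<omega>. (X' i \<omega>)\<^sup>2)" "expectation (X' i) = 0" "expectation (\<lambda>\<omega>. (X' i \<omega>)\<^sup>2) = \<sigma>\<^sub>0\<^sup>2"
      unfolding X'_def using X1 *[of "\<lambda>x. (x - \<mu>\<^sub>0)\<^sup>2"] *[of "\<lambda>x. x - \<mu>\<^sub>0"]
      by (auto simp: power2_diff prob_space)
  qed
  define C\<^sub>1 where "C\<^sub>1 = 29 + 20 * (\<integral>x. \<bar>x\<bar> ^ 3 \<partial>\<mu>)"
  \<comment> \<open>The 1 pays for \<open>std_normal_cdf_scale\<close>, the ratio of variances for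
    the second moment of \<open>U\<close>.\<close>
  define C\<^sub>2 where "C\<^sub>2 = 1 + \<sigma>\<^sub>0\<^sup>2 / \<sigma>\<^sub>1\<^sup>2"
  have "0 \<le> C\<^sub>1" "0 \<le> C\<^sub>2" by (auto simp: C\<^sub>1_def C\<^sub>2_def)
  show ?thesis
  proof (rule that[of "C\<^sub>1 + C\<^sub>2"])
    fix n k :: nat and x :: real
    assume n: "n \<ge> 1" and k: "k \<ge> 1"
    define T where "T = (\<lambda>\<omega>. (\<Sum>j=1..k. Z j \<omega>) / sqrt k)"
    define U where "U = (\<lambda>\<omega>. sqrt k / (n * \<sigma>\<^sub>1) * (\<Sum>i=1..n. X' i \<omega>))"
    define m where "m = sqrt k * (\<mu>\<^sub>1 - \<mu>\<^sub>0) / \<sigma>\<^sub>1"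
    define y where "y = x - real n / (real n + real k) * m"

    have ind: "indep_var borel T borel U"
    proof -
      \<comment> \<open>Both variables are measurable functions of the entire sequences, so their
        independence follows from that of the sequences.\<close>
      let ?gU = "\<lambda>f. sqrt k / (n * \<sigma>\<^sub>1) * (\<Sum>i=1..n. f i - \<mu>\<^sub>0)"
      let ?gT = "\<lambda>f. (\<Sum>j=1..k. (f j - \<mu>\<^sub>1) / \<sigma>\<^sub>1) / sqrt k"
      have "indep_var borel (?gU \<circ> (\<lambda>\<omega>. \<lambda>i\<in>{1..}. X i \<omega>)) borel (?gT \<circ> (\<lambda>\<omega>. \<lambda>j\<in>{1..}. Y j \<omega>))"
        by (rule indep_var_compose[OF XY[unfolded indep_sequences_def]]) measurable
      moreover have "?gU \<circ> (\<lambda>\<omega>. \<lambda>i\<in>{1..}. X i \<omega>) = U"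
        by (auto simp: U_def X'_def comp_def fun_eq_iff intro!: sum.cong)
      moreover have "?gT \<circ> (\<lambda>\<omega>. \<lambda>j\<in>{1..}. Y j \<omega>) = T"
        by (auto simp: T_def Z_def comp_def fun_eq_iff intro!: sum.cong)
      ultimately show ?thesis by (simp add: indep_var_swap)
    qed
    have T: "\<bar>prob {\<omega> \<in> space M. T \<omega> \<le> t} - \<Phi> t\<bar> \<le> C\<^sub>1 / sqrt k" for t
      unfolding T_def C\<^sub>1_def
      by (rule berry_esseen_iid[OF indZ k distrZ Z1(1,2,3,4)]) auto
    note SX = sum_indep_second_moment[OF indX[of n] finite_atLeastAtMost, where s = "\<sigma>\<^sub>0\<^sup>2"]
    have SX: "integrable M (\<lambda>\<omega>. (\<Sum>i=1..n. X' i \<omega>)\<^sup>2)" "expectation (\<lambda>\<omega>. \<Sum>i=1..n. X' i \<omega>) = 0"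
      "expectation (\<lambda>\<omega>. (\<Sum>i=1..n. X' i \<omega>)\<^sup>2) = n * \<sigma>\<^sub>0\<^sup>2"
      using X2 SX by simp_all
    have U: "integrable M (\<lambda>\<omega>. (U \<omega>)\<^sup>2)" "expectation U = 0" "expectation (\<lambda>\<omega>. (U \<omega>)\<^sup>2) = k / n * (\<sigma>\<^sub>0\<^sup>2 / \<sigma>\<^sub>1\<^sup>2)"
      using SX n \<sigma>\<^sub>1 by (simp_all add: U_def power_mult_distrib power_divide power2_eq_square[of "real n"])

    have event: "Delta_add X Y n k \<omega> \<le> sqrt k * \<sigma>\<^sub>1 * x / n \<longleftrightarrow> T \<omega> - U \<omega> \<le> (1 + k / n) * y" for \<omega>
    proof -
      \<comment> \<open>Writing k as s * s turns the comparison into an identity of rational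
        functions in s.\<close>
      define s where "s = sqrt k"
      have s: "s > 0" "real k = s * s" using k by (auto simp: s_def)
      have np: "real n > 0" using n by simp
      have nz: "real n + s * s \<noteq> 0" "s \<noteq> 0" "\<sigma>\<^sub>1 \<noteq> 0" "real n \<noteq> 0"
        using np s \<sigma>\<^sub>1 add_pos_pos[of "real n" "s * s"] by auto
      define SX where "SX = (\<Sum>i=1..n. X i \<omega>)"
      define SY where "SY = (\<Sum>j=1..k. Y j \<omega>)"
      have Tw: "T \<omega> = (SY - k * \<mu>\<^sub>1) / (\<sigma>\<^sub>1 * s)"
        by (simp add: T_def Z_def SY_def s_def sum_divide_distrib[symmetric] sum_subtractf)
      have Uw: "U \<omega> = s / (n * \<sigma>\<^sub>1) * (SX - n * \<mu>\<^sub>0)"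
        by (simp add: U_def X'_def SX_def s_def sum_subtractf)
      have 1: "Delta_add X Y n k \<omega> = (n * SY - s * s * SX) / (n * (n + s * s))"
        using nz unfolding Delta_add_def SX_def[symmetric] SY_def[symmetric] s(2)
        by (simp add: divide_simps) (simp add: algebra_simps)
      have 2: "(1 + k / n) * y = (1 + s * s / n) * x - s * (\<mu>\<^sub>1 - \<mu>\<^sub>0) / \<sigma>\<^sub>1"
        using nz unfolding y_def m_def s_def[symmetric] unfolding s(2)
        by (simp add: divide_simps)
      have pos: "0 < s * \<sigma>\<^sub>1 / (n + s * s)" using np s \<sigma>\<^sub>1 by (simp add: add_pos_pos)
      \<comment> \<open>The two sides of the equivalence differ by a positive factor, so their signs
        agree.\<close>
      have "Delta_add X Y n k \<omega> - s * \<sigma>\<^sub>1 * x / n = s * \<sigma>\<^sub>1 / (n + s * s) * (T \<omega> - U \<omega> - (1 + k / n) * y)"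
        using nz unfolding 1 2 Tw Uw unfolding s(2)
        by (simp add: divide_simps) (simp add: algebra_simps)
      then have "Delta_add X Y n k \<omega> - s * \<sigma>\<^sub>1 * x / n \<le> 0 \<longleftrightarrow> T \<omega> - U \<omega> - (1 + k / n) * y \<le> 0"
        using pos by (simp only: mult_le_0_iff) linarith
      then show ?thesis by (simp add: s_def)
    qed
    have "distribution_function M (Delta_add X Y n k) (sqrt k * \<sigma>\<^sub>1 * x / n)
        = prob {\<omega> \<in> space M. T \<omega> - U \<omega> \<le> (1 + k / n) * y}"
    proof -
      have "Delta_add X Y n k \<in> borel_measurable M"
        unfolding Delta_add_def[abs_def] using rvX rvY
        by (intro borel_measurable_diff borel_measurable_times borel_measurable_add borel_measurable_sum borel_measurable_const) auto
      then show ?thesis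
        unfolding distribution_function_def cdf_def
        by (subst measure_distr) (auto intro!: arg_cong[where f = prob] simp: event)
    qed
    then have "\<bar>distribution_function M (Delta_add X Y n k) (sqrt k * \<sigma>\<^sub>1 * x / n) - \<Phi> y\<bar>
        \<le> C\<^sub>1 / sqrt k + k / n * (\<sigma>\<^sub>0\<^sup>2 / \<sigma>\<^sub>1\<^sup>2) + k / n"
      using normal_approximation_perturbed[OF ind T U(1,2), of "(1 + k / n) * y"]
        std_normal_cdf_scale[of "k / n" y] unfolding U(3) by simp
    also have "\<dots> = C\<^sub>1 * (1 / sqrt k) + C\<^sub>2 * (k / n)"
      by (simp add: C\<^sub>2_def algebra_simps)
    also have "\<dots> \<le> (C\<^sub>1 + C\<^sub>2) * (1 / sqrt k) + (C\<^sub>1 + C\<^sub>2) * (k / n)"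
      using \<open>0 \<le> C\<^sub>1\<close> \<open>0 \<le> C\<^sub>2\<close> by (intro add_mono mult_right_mono) auto
    finally show "\<bar>distribution_function M (Delta_add X Y n k) (sqrt k * \<sigma>\<^sub>1 * x / n)
       - \<Phi> (x - real n / (real n + real k) * (sqrt k * (\<mu>\<^sub>1 - \<mu>\<^sub>0) / \<sigma>\<^sub>1))\<bar>
     \<le> (C\<^sub>1 + C\<^sub>2) * (1 / sqrt k + k / n)"
      by (simp add: y_def m_def distrib_left)
  qed
qed

lemma eventually_sampling_rate:
  fixes k :: "nat \<Rightarrow> nat"
  assumes lim: "(\<lambda>n. real (k n) / real n powr \<alpha>) \<longlonglongrightarrow> 1"
  shows "eventually (\<lambda>n. 1 / sqrt (k n) \<le> 2 * real n powr (- min (\<alpha> / 2) (1 - \<alpha>)) \<and>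
    k n / n \<le> 2 * real n powr (- min (\<alpha> / 2) (1 - \<alpha>))) sequentially"
proof -
  \<comment> \<open>The lower bound 1/4 has square root 1/2, so 1 / sqrt k gets the same factor 2
    that the upper bound gives to k / n.\<close>
  have "eventually (\<lambda>n. 1 / 4 < real (k n) / real n powr \<alpha>) sequentially"
    "eventually (\<lambda>n. real (k n) / real n powr \<alpha> < 2) sequentially"
    by (rule order_tendstoD[OF lim]; simp)+
  then show ?thesis using eventually_ge_at_top[of 1]
  proof eventually_elim
    case (elim n)
    let ?\<beta> = "min (\<alpha> / 2) (1 - \<alpha>)"
    have n: "real n \<ge> 1" using elim by simp
    have \<beta>: "- (\<alpha> / 2) \<le> - ?\<beta>" "- (1 - \<alpha>) \<le> - ?\<beta>"
      by (simp_all only: neg_le_iff_le min.cobounded1 min.cobounded2)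
    have pos: "real n powr \<alpha> > 0" using n by simp
    have lo: "real n powr \<alpha> / 4 \<le> k n" and hi: "k n \<le> 2 * real n powr \<alpha>"
      using elim pos by (auto simp: field_simps)
    have sq: "sqrt (real n powr \<alpha> / 4) = real n powr (\<alpha> / 2) / 2"
      using n by (simp add: real_sqrt_divide powr_half_sqrt[symmetric] powr_powr)
    have "real n powr (\<alpha> / 2) / 2 \<le> sqrt (k n)"
      unfolding sq[symmetric] using lo by simp
    moreover have "0 < real n powr (\<alpha> / 2) / 2" using n by simp
    ultimately have "1 / sqrt (k n) \<le> 1 / (real n powr (\<alpha> / 2) / 2)"
      by (rule frac_le[OF zero_le_one order_refl, rotated])
    also have "\<dots> = 2 * real n powr (- (\<alpha> / 2))"
      by (simp add: powr_minus field_simps)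
    also have "\<dots> \<le> 2 * real n powr (- ?\<beta>)"
      by (intro mult_left_mono powr_mono \<beta> n) simp
    finally have 1: "1 / sqrt (k n) \<le> 2 * real n powr (- ?\<beta>)" .
    have "k n / n \<le> 2 * real n powr \<alpha> / n" using hi n by (intro divide_right_mono) auto
    also have "\<dots> = 2 * real n powr (- (1 - \<alpha>))"
      using n by (simp add: powr_diff)
    also have "\<dots> \<le> 2 * real n powr (- ?\<beta>)"
      by (intro mult_left_mono powr_mono \<beta> n) simp
    finally show ?case using 1 by simp
  qed
qed

theorem theorem3p3:
  fixes M :: "'a measure"
    and X Y :: "nat \<Rightarrow> 'a \<Rightarrow> real"
    and F\<^sub>0 F\<^sub>1 :: "real \<Rightarrow> real"
    and F_plus :: "nat \<Rightarrow> real \<Rightarrow> real"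
    and \<mu>\<^sub>0 \<mu>\<^sub>1 \<sigma>\<^sub>0 \<sigma>\<^sub>1 \<alpha> \<beta> :: real
    and k :: "nat \<Rightarrow> nat"
  assumes "prob_space M"
    and "iid_with_df M X F\<^sub>0"
    and "iid_with_df M Y F\<^sub>1"
    and "indep_sequences M X Y"
    and "integrable M (X 1)" and "prob_space.expectation M (X 1) = \<mu>\<^sub>0"
    and "integrable M (Y 1)" and "prob_space.expectation M (Y 1) = \<mu>\<^sub>1"
    and "integrable M (\<lambda>\<omega>. (X 1 \<omega>)\<^sup>2)" and "prob_space.variance M (X 1) = \<sigma>\<^sub>0\<^sup>2"
    and "integrable M (\<lambda>\<omega>. (Y 1 \<omega>)\<^sup>2)" and "prob_space.variance M (Y 1) = \<sigma>\<^sub>1\<^sup>2"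
    and "\<sigma>\<^sub>1 > 0"
    and "integrable M (\<lambda>\<omega>. \<bar>Y 1 \<omega>\<bar> ^ 3)"
    and "0 < \<alpha>" and "\<alpha> < 1"
    and "\<forall>n\<ge>1. k n > 0"
    and "(\<lambda>n. real (k n) / real n powr \<alpha>) \<longlonglongrightarrow> 1"
    and "\<forall>n\<ge>1. F_plus n = distribution_function M (Delta_add X Y n (k n))"
    and "\<beta> = min (\<alpha> / 2) (1 - \<alpha>)"
  shows
    "bigo_uniformly_on UNIV
       (\<lambda>n x. F_plus n (sqrt (real (k n)) * \<sigma>\<^sub>1 * x / real n)
          - \<Phi> (x - real n / (real n + real (k n)) * (sqrt (real (k n)) * (\<mu>\<^sub>1 - \<mu>\<^sub>0) / \<sigma>\<^sub>1)))
       (\<lambda>n. real n powr (- \<beta>))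
     \<and> (\<mu>\<^sub>1 \<noteq> \<mu>\<^sub>0 \<longrightarrow>
         (\<forall>B. bounded B \<longrightarrow>
           bigo_uniformly_on B
             (\<lambda>n x. F_plus n (sqrt (real (k n)) * \<sigma>\<^sub>1 * x / real n)
                - \<Phi> (x - sqrt (real (k n)) * (\<mu>\<^sub>1 - \<mu>\<^sub>0) / \<sigma>\<^sub>1))
             (\<lambda>n. real n powr (- \<beta>))))"
proof -
  interpret prob_space M by fact
  obtain C where C: "\<And>n k x. n \<ge> 1 \<Longrightarrow> k \<ge> 1 \<Longrightarrow>
    \<bar>distribution_function M (Delta_add X Y n k) (sqrt k * \<sigma>\<^sub>1 * x / n)
       - \<Phi> (x - real n / (real n + real k) * (sqrt k * (\<mu>\<^sub>1 - \<mu>\<^sub>0) / \<sigma>\<^sub>1))\<bar>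
     \<le> C * (1 / sqrt k + k / n)"
    by (rule Delta_add_normal_approximation[OF assms(2,3,4,5,6,9,10,7,8,11,12,14,13)]) blast
  let ?e = "\<lambda>n x. F_plus n (sqrt (real (k n)) * \<sigma>\<^sub>1 * x / real n)
    - \<Phi> (x - real n / (real n + real (k n)) * (sqrt (real (k n)) * (\<mu>\<^sub>1 - \<mu>\<^sub>0) / \<sigma>\<^sub>1))"
  \<comment> \<open>The bound on k / n is kept beside the error bound, because the second claim uses
    it again. The 4 adds the factors 2 of the two error terms.\<close>
  have rate: "eventually (\<lambda>n. n \<ge> 1 \<and> k n / n \<le> 2 * real n powr (- \<beta>) \<and> (\<forall>x. \<bar>?e n x\<bar> \<le> \<bar>C\<bar> * 4 * real n powr (- \<beta>))) sequentially"
    using eventually_sampling_rate[OF assms(18)] eventually_ge_at_top[of 1]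
  proof eventually_elim
    case (elim n)
    have "\<bar>?e n x\<bar> \<le> \<bar>C\<bar> * 4 * real n powr (- \<beta>)" for x
    proof -
      have "\<bar>?e n x\<bar> \<le> C * (1 / sqrt (k n) + k n / n)"
        using C[of n "k n" x] assms(17,19) elim by (simp add: Suc_leI)
      also have "\<dots> \<le> \<bar>C\<bar> * (1 / sqrt (k n) + k n / n)"
        by (intro mult_right_mono) auto
      also have "\<dots> \<le> \<bar>C\<bar> * (4 * real n powr (- \<beta>))"
        using elim by (intro mult_left_mono) (auto simp: assms(20))
      finally show ?thesis by simp
    qed
    then show ?case using elim by (simp add: assms(20))
  qed
  show ?thesis
  proof (intro conjI impI allI)
    show "bigo_uniformly_on UNIV ?e (\<lambda>n. real n powr (- \<beta>))"
      by (rule bigo_uniformly_onI[where C = "\<bar>C\<bar> * 4"]) (use rate in \<open>auto elim: eventually_mono\<close>)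
    fix B :: "real set"
    assume "bounded B"
    then obtain b where b: "\<And>x. x \<in> B \<Longrightarrow> \<bar>x\<bar> \<le> b" "b > 0"
      unfolding bounded_pos by auto
    show "bigo_uniformly_on B
       (\<lambda>n x. F_plus n (sqrt (real (k n)) * \<sigma>\<^sub>1 * x / real n)
          - \<Phi> (x - sqrt (real (k n)) * (\<mu>\<^sub>1 - \<mu>\<^sub>0) / \<sigma>\<^sub>1)) (\<lambda>n. real n powr (- \<beta>))"
    \<comment> \<open>The first part of the constant is the error of the first claim, the second the
      cost of replacing n / (n + k) by 1 for |x| \<le> b.\<close>
    proof (rule bigo_uniformly_onI[where C = "\<bar>C\<bar> * 4 + (4 + 4 * b) * 2"])
      show "\<forall>\<^sub>F n in sequentially. \<forall>x\<in>B. \<bar>F_plus n (sqrt (real (k n)) * \<sigma>\<^sub>1 * x / real n)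
          - \<Phi> (x - sqrt (real (k n)) * (\<mu>\<^sub>1 - \<mu>\<^sub>0) / \<sigma>\<^sub>1)\<bar> \<le> (\<bar>C\<bar> * 4 + (4 + 4 * b) * 2) * real n powr (- \<beta>)"
        using rate
      proof eventually_elim
        case (elim n)
        show ?case
        proof
          fix x assume "x \<in> B"
          let ?m = "sqrt (real (k n)) * (\<mu>\<^sub>1 - \<mu>\<^sub>0) / \<sigma>\<^sub>1"
          have "\<bar>\<Phi> (x - real n / (real n + real (k n)) * ?m) - \<Phi> (x - ?m)\<bar> \<le> (4 + 4 * b) * (k n / n)"
            using elim b(1)[OF \<open>x \<in> B\<close>] by (intro std_normal_cdf_shift) auto
          also have "\<dots> \<le> (4 + 4 * b) * (2 * real n powr (- \<beta>))"
            using elim b by (intro mult_left_mono) auto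
          finally have "\<bar>\<Phi> (x - real n / (real n + real (k n)) * ?m) - \<Phi> (x - ?m)\<bar>
            \<le> (4 + 4 * b) * (2 * real n powr (- \<beta>))" .
          moreover have "\<bar>?e n x\<bar> \<le> \<bar>C\<bar> * 4 * real n powr (- \<beta>)" using elim by blast
          moreover have "(\<bar>C\<bar> * 4 + (4 + 4 * b) * 2) * real n powr (- \<beta>)
            = \<bar>C\<bar> * 4 * real n powr (- \<beta>) + (4 + 4 * b) * (2 * real n powr (- \<beta>))"
            by (simp add: algebra_simps)
          ultimately show "\<bar>F_plus n (sqrt (real (k n)) * \<sigma>\<^sub>1 * x / real n) - \<Phi> (x - ?m)\<bar>
            \<le> (\<bar>C\<bar> * 4 + (4 + 4 * b) * 2) * real n powr (- \<beta>)" by linarith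
        qed
      qed
    qed simp
  qed
qed

end
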